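(* For any symmetric monoidal categories $\mathcal A$ and $\mathcal B$, the composite $S_{\mathcal B,\mathcal A}\circ S_{\mathcal A,\mathcal B}$ is the identity at $\mathcal A\otimes\mathcal B$ in $\mathrm{SMC}$.
   Context: **Basics.** All symmetric monoidal categories are small, with tensor $\otimes$, unit $I$ and natural isomorphisms $ass_{a,b,c}:a\otimes(b\otimes c)\to(a\otimes b)\otimes c$, $r_a:a\otimes I\to a$, $l_a:I\otimes a\to a$, $s_{a,b}:a\otimes b\to b\otimes a$ satisfying the usual coherence axioms. A symmetric monoidal functor $F:\mathcal A\to\mathcal B$ is a lax one: a functor with an arrow $F^0:I\to F(I)$ and a natural family $F^2_{x,y}:Fx\otimes Fy\to F(x\otimes y)$ satisfying the usual associativity, unit and symmetry axioms; it is strict if $F^0$ and all $F^2_{x,y}$ are identities. $\mathrm{SMC}$ is the 2-category of symmetric monoidal categories, symmetric monoidal functors and monoidal natural transformations. **Internal hom.** $[\mathcal A,\mathcal B]$ is the category $\mathrm{SMC}(\mathcal A,\mathcal B)$ with the pointwise symmetric monoidal structure: $(F\Box G)(a)=Fa\otimes Ga$, $(F\Box G)^0$ is $I\cong I\otimes I\xrightarrow{F^0\otimes G^0}F(I)\otimes G(I)$, $(F\Box G)^2_{a,b}$ is the canonical interchange $(Fa\otimes Ga)\otimes(Fb\otimes Gb)\cong(Fa\otimes Fb)\otimes(Ga\otimes Gb)$ followed by $F^2_{a,b}\otimes G^2_{a,b}$; $(\sigma\Box\tau)_a=\sigma_a\otimes\tau_a$; the unit is the constant functor at $I_{\mathcal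 B}$ (with $I\to I$ the identity and $I\otimes I\to I$ the canonical arrow); $ass,r,l,s$ are pointwise. **Duality.** For $F:\mathcal A\to[\mathcal B,\mathcal C]$ in $\mathrm{SMC}$, its dual $F^*:\mathcal B\to[\mathcal A,\mathcal C]$ is given by $F^*(b)(a)=F(a)(b)$, $F^*(b)(f)=F(f)_b$, $(F^*b)^0=(F^0)_b$, $(F^*b)^2_{a,a'}=(F^2_{a,a'})_b$, $F^*(g)_a=F(a)(g)$, $((F^* )^0)_a=(Fa)^0$, $((F^* )^2_{b,b'})_a=(Fa)^2_{b,b'}$. **Tensor.** $\mathcal A\otimes\mathcal B$ is the following symmetric monoidal category. Its objects are the formal words freely generated from a constant $I$ and symbols $a\otimes b$ ($a$ in $\mathcal A$, $b$ in $\mathcal B$) under a formal binary operation $X\otimes Y$. Its arrows are freely generated, under composition and the operations $p\mapsto X\otimes p$, $p\mapsto p\otimes X$ for objects $X$, by formal arrows $ass,r,l$ (with formal inverses) and $s$ for all objects, and by arrows $\alpha_b:I\to I_{\mathcal A}\otimes b$; $\beta_a:I\to a\otimes I_{\mathcal B}$; $\gamma_{a,a',b}:(a\otimes b)\otimes(a'\otimes b)\to(a\otimes a')\otimes b$; $\delta_{a,b,b'}:(a\otimes b)\otimes(a\otimes b')\to a\otimes(b\otimes b')$; $a\otimes g:a\otimes b\to a\otimes b'$ for $g:b\to b'$ in $\mathcal B$; $f\otimes b:a\otimes b\to a'\otimes b$ for $f:a\to a'$ in $\mathcal A$; modulo the smallest congruence, compatible with all $X\otimes-$ and $-\otimes X$,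 such that: (i) $\otimes$ is a bifunctor and $\otimes,I,ass,r,l,s$ form a symmetric monoidal structure; (ii) for each $a$, $b\mapsto a\otimes b$, $g\mapsto a\otimes g$ with structure $\beta_a$, $\delta_{a,-,-}$ is a symmetric monoidal functor $\eta(a):\mathcal B\to\mathcal A\otimes\mathcal B$; (iii) for each $b$, $a\mapsto a\otimes b$, $f\mapsto f\otimes b$ with structure $\alpha_b$, $\gamma_{-,-,b}$ is a symmetric monoidal functor $\mathcal A\to\mathcal A\otimes\mathcal B$; (iv) for each $f:a\to a'$ the family $(f\otimes b)_b$, and for each $g:b\to b'$ the family $(a\otimes g)_a$, is a monoidal natural transformation between the corresponding functors of (ii), resp. (iii); (v) with $c:I\otimes I\to I$ canonical, $\alpha_{b\otimes b'}\circ c=\delta_{I_{\mathcal A},b,b'}\circ(\alpha_b\otimes\alpha_{b'})$, $\beta_{a\otimes a'}\circ c=\gamma_{a,a',I_{\mathcal B}}\circ(\beta_a\otimes\beta_{a'})$, and $\beta_{I_{\mathcal A}}=\alpha_{I_{\mathcal B}}$; (vi) $\gamma_{a,a',b\otimes b'}\circ(\delta_{a,b,b'}\otimes\delta_{a',b,b'})=\delta_{a\otimes a',b,b'}\circ(\gamma_{a,a',b}\otimes\gamma_{a,a',b'})\circ m$, where $m$ is the canonical isomorphism exchanging the two middle factors $a\otimes b'$ and $a'\otimes b$. The symmetric monoidal functor $\eta:\mathcal A\to[\mathcal B,\mathcal A\otimes\mathcal B]$ is $a\mapsto\eta(a)$, $\eta(f)_b=f\otimes b$, $(\eta^0)_b=\alpha_b$,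 $(\eta^2_{a,a'})_b=\gamma_{a,a',b}$. **$En$ and $S$.** For $F:\mathcal A\to[\mathcal B,\mathcal C]$, $En(F):\mathcal A\otimes\mathcal B\to\mathcal C$ is the strict symmetric monoidal functor with $a\otimes b\mapsto F(a)(b)$, $\alpha_b\mapsto(F^0)_b$, $\beta_a\mapsto(Fa)^0$, $\gamma_{a,a',b}\mapsto(F^2_{a,a'})_b$, $\delta_{a,b,b'}\mapsto(Fa)^2_{b,b'}$, $f\otimes b\mapsto F(f)_b$, $a\otimes g\mapsto F(a)(g)$. $S_{\mathcal A,\mathcal B}=En(\eta^* ):\mathcal A\otimes\mathcal B\to\mathcal B\otimes\mathcal A$, where $\eta^*:\mathcal A\to[\mathcal B,\mathcal B\otimes\mathcal A]$ is the dual of $\eta:\mathcal B\to[\mathcal A,\mathcal B\otimes\mathcal A]$. *)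

theory Defs
  imports Main "HOL-Library.FuncSet"
begin

section \<open>Symmetric monoidal categories\<close>

text \<open>
  A category is given by its set of objects and its set of arrows; \<open>cmp g f\<close> is \<open>g\<close> after \<open>f\<close>.
  The inverses of the structural isomorphisms are part of the data, subject to the inverse laws below.
  They are therefore uniquely determined by the rest of the structure.
\<close>

record ('o, 'a) smcat =
  Ob :: "'o set"
  Ar :: "'a set"
  Dom :: "'a \<Rightarrow> 'o"
  Cod :: "'a \<Rightarrow> 'o"
  idn :: "'o \<Rightarrow> 'a"
  cmp :: "'a \<Rightarrow> 'a \<Rightarrow> 'a"  (infixr "\<cdot>\<index>" 55)
  unit_ob :: "'o"
  ten_ob :: "'o \<Rightarrow> 'o \<Rightarrow> 'o"  (infixr "\<otimes>\<index>" 65)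
  ten_ar :: "'a \<Rightarrow> 'a \<Rightarrow> 'a"  (infixr "\<boxtimes>\<index>" 65)
  ass :: "'o \<Rightarrow> 'o \<Rightarrow> 'o \<Rightarrow> 'a"
  ass_inv :: "'o \<Rightarrow> 'o \<Rightarrow> 'o \<Rightarrow> 'a"
  runit :: "'o \<Rightarrow> 'a"
  runit_inv :: "'o \<Rightarrow> 'a"
  lunit :: "'o \<Rightarrow> 'a"
  lunit_inv :: "'o \<Rightarrow> 'a"
  symm :: "'o \<Rightarrow> 'o \<Rightarrow> 'a"

definition Hom :: "('o, 'a) smcat \<Rightarrow> 'o \<Rightarrow> 'o \<Rightarrow> 'a set" where
  "Hom C x y = {f \<in> Ar C. Dom C f = x \<and> Cod C f = y}"

locale smc_typing =
  fixes C :: "('o, 'a) smcat" (structure)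
  assumes Dom_Ob: "f \<in> Ar C \<Longrightarrow> Dom C f \<in> Ob C"
    and Cod_Ob: "f \<in> Ar C \<Longrightarrow> Cod C f \<in> Ob C"
    and idn_Hom: "x \<in> Ob C \<Longrightarrow> idn C x \<in> Hom C x x"
    and cmp_Hom: "f \<in> Hom C x y \<Longrightarrow> g \<in> Hom C y z \<Longrightarrow> g \<cdot> f \<in> Hom C x z"
    and unit_Ob: "unit_ob C \<in> Ob C"
    and ten_Ob: "x \<in> Ob C \<Longrightarrow> y \<in> Ob C \<Longrightarrow> x \<otimes> y \<in> Ob C"
    and ten_Hom: "f \<in> Hom C x y \<Longrightarrow> g \<in> Hom C x' y' \<Longrightarrow> f \<boxtimes> g \<in> Hom C (x \<otimes> x') (y \<otimes> y')"
    and ass_Hom: "x \<in> Ob C \<Longrightarrow> y \<in> Ob C \<Longrightarrow> z \<in> Ob C \<Longrightarrow>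
          ass C x y z \<in> Hom C (x \<otimes> (y \<otimes> z)) ((x \<otimes> y) \<otimes> z)"
    and ass_inv_Hom: "x \<in> Ob C \<Longrightarrow> y \<in> Ob C \<Longrightarrow> z \<in> Ob C \<Longrightarrow>
          ass_inv C x y z \<in> Hom C ((x \<otimes> y) \<otimes> z) (x \<otimes> (y \<otimes> z))"
    and runit_Hom: "x \<in> Ob C \<Longrightarrow> runit C x \<in> Hom C (x \<otimes> unit_ob C) x"
    and runit_inv_Hom: "x \<in> Ob C \<Longrightarrow> runit_inv C x \<in> Hom C x (x \<otimes> unit_ob C)"
    and lunit_Hom: "x \<in> Ob C \<Longrightarrow> lunit C x \<in> Hom C (unit_ob C \<otimes> x) x"
    and lunit_inv_Hom: "x \<in> Ob C \<Longrightarrow> lunit_inv C x \<in> Hom C x (unit_ob C \<otimes> x)"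
    and symm_Hom: "x \<in> Ob C \<Longrightarrow> y \<in> Ob C \<Longrightarrow> symm C x y \<in> Hom C (x \<otimes> y) (y \<otimes> x)"

text \<open>
  The equational axioms are stated up to a relation on arrows. With \<open>(=)\<close> they are the axioms of
  a symmetric monoidal category, with other relations they describe the congruence that defines
  the tensor product.
\<close>

locale smc_laws =
  fixes C :: "('o, 'a) smcat" (structure)
    and eq :: "'a \<Rightarrow> 'a \<Rightarrow> bool" (infix "\<approx>" 50)
  assumes cmp_assoc: "f \<in> Hom C w x \<Longrightarrow> g \<in> Hom C x y \<Longrightarrow> h \<in> Hom C y z \<Longrightarrow>
          h \<cdot> (g \<cdot> f) \<approx> (h \<cdot> g) \<cdot> f"
    and idn_left: "f \<in> Hom C x y \<Longrightarrow> idn C y \<cdot> f \<approx> f"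
    and idn_right: "f \<in> Hom C x y \<Longrightarrow> f \<cdot> idn C x \<approx> f"
    and ten_idn: "x \<in> Ob C \<Longrightarrow> y \<in> Ob C \<Longrightarrow> idn C x \<boxtimes> idn C y \<approx> idn C (x \<otimes> y)"
    and ten_cmp: "f \<in> Hom C x y \<Longrightarrow> g \<in> Hom C y z \<Longrightarrow> f' \<in> Hom C x' y' \<Longrightarrow> g' \<in> Hom C y' z' \<Longrightarrow>
          (g \<cdot> f) \<boxtimes> (g' \<cdot> f') \<approx> (g \<boxtimes> g') \<cdot> (f \<boxtimes> f')"
    and ass_inv_ass: "x \<in> Ob C \<Longrightarrow> y \<in> Ob C \<Longrightarrow> z \<in> Ob C \<Longrightarrow>
          ass_inv C x y z \<cdot> ass C x y z \<approx> idn C (x \<otimes> (y \<otimes> z))"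
    and ass_ass_inv: "x \<in> Ob C \<Longrightarrow> y \<in> Ob C \<Longrightarrow> z \<in> Ob C \<Longrightarrow>
          ass C x y z \<cdot> ass_inv C x y z \<approx> idn C ((x \<otimes> y) \<otimes> z)"
    and runit_inv_runit: "x \<in> Ob C \<Longrightarrow> runit_inv C x \<cdot> runit C x \<approx> idn C (x \<otimes> unit_ob C)"
    and runit_runit_inv: "x \<in> Ob C \<Longrightarrow> runit C x \<cdot> runit_inv C x \<approx> idn C x"
    and lunit_inv_lunit: "x \<in> Ob C \<Longrightarrow> lunit_inv C x \<cdot> lunit C x \<approx> idn C (unit_ob C \<otimes> x)"
    and lunit_lunit_inv: "x \<in> Ob C \<Longrightarrow> lunit C x \<cdot> lunit_inv C x \<approx> idn C x"
    and ass_nat: "f \<in> Hom C x x' \<Longrightarrow> g \<in> Hom C y y' \<Longrightarrow> h \<in> Hom C z z' \<Longrightarrow>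
          ass C x' y' z' \<cdot> (f \<boxtimes> (g \<boxtimes> h)) \<approx> ((f \<boxtimes> g) \<boxtimes> h) \<cdot> ass C x y z"
    and runit_nat: "f \<in> Hom C x x' \<Longrightarrow>
          runit C x' \<cdot> (f \<boxtimes> idn C (unit_ob C)) \<approx> f \<cdot> runit C x"
    and lunit_nat: "f \<in> Hom C x x' \<Longrightarrow>
          lunit C x' \<cdot> (idn C (unit_ob C) \<boxtimes> f) \<approx> f \<cdot> lunit C x"
    and symm_nat: "f \<in> Hom C x x' \<Longrightarrow> g \<in> Hom C y y' \<Longrightarrow>
          symm C x' y' \<cdot> (f \<boxtimes> g) \<approx> (g \<boxtimes> f) \<cdot> symm C x y"
    and symm_symm: "x \<in> Ob C \<Longrightarrow> y \<in> Ob C \<Longrightarrow> symm C y x \<cdot> symm C x y \<approx> idn C (x \<otimes> y)"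
    and pentagon: "w \<in> Ob C \<Longrightarrow> x \<in> Ob C \<Longrightarrow> y \<in> Ob C \<Longrightarrow> z \<in> Ob C \<Longrightarrow>
          ass C (w \<otimes> x) y z \<cdot> ass C w x (y \<otimes> z) \<approx>
          (ass C w x y \<boxtimes> idn C z) \<cdot> (ass C w (x \<otimes> y) z \<cdot> (idn C w \<boxtimes> ass C x y z))"
    and triangle: "x \<in> Ob C \<Longrightarrow> y \<in> Ob C \<Longrightarrow>
          (runit C x \<boxtimes> idn C y) \<cdot> ass C x (unit_ob C) y \<approx> idn C x \<boxtimes> lunit C y"
    and hexagon: "x \<in> Ob C \<Longrightarrow> y \<in> Ob C \<Longrightarrow> z \<in> Ob C \<Longrightarrow>
          ass C z x y \<cdot> (symm C (x \<otimes> y) z \<cdot> ass C x y z) \<approx>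
          (symm C x z \<boxtimes> idn C y) \<cdot> (ass C x z y \<cdot> (idn C x \<boxtimes> symm C y z))"
    and runit_symm: "x \<in> Ob C \<Longrightarrow> lunit C x \<cdot> symm C x (unit_ob C) \<approx> runit C x"

definition symmetric_monoidal_category :: "('o, 'a) smcat \<Rightarrow> bool" where
  "symmetric_monoidal_category C \<longleftrightarrow> smc_typing C \<and> smc_laws C (=)"

text \<open>The canonical arrow \<open>(x \<otimes> y) \<otimes> (z \<otimes> w) \<rightarrow> (x \<otimes> z) \<otimes> (y \<otimes> w)\<close>.\<close>

definition interchange :: "('o, 'a) smcat \<Rightarrow> 'o \<Rightarrow> 'o \<Rightarrow> 'o \<Rightarrow> 'o \<Rightarrow> 'a" where
  "interchange C x y z w =
     ass_inv C (x \<otimes>\<^bsub>C\<^esub> z) y w \<cdot>\<^bsub>C\<^esub>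
     ((ass C x z y \<boxtimes>\<^bsub>C\<^esub> idn C w) \<cdot>\<^bsub>C\<^esub>
     (((idn C x \<boxtimes>\<^bsub>C\<^esub> symm C y z) \<boxtimes>\<^bsub>C\<^esub> idn C w) \<cdot>\<^bsub>C\<^esub>
     ((ass_inv C x y z \<boxtimes>\<^bsub>C\<^esub> idn C w) \<cdot>\<^bsub>C\<^esub>
     ass C (x \<otimes>\<^bsub>C\<^esub> y) z w)))"


section \<open>Symmetric monoidal functors and monoidal natural transformations\<close>

record ('oa, 'aa, 'ob, 'ab) smf =
  fob :: "'oa \<Rightarrow> 'ob"
  far :: "'aa \<Rightarrow> 'ab"
  fzero :: "'ab"
  ftwo :: "'oa \<Rightarrow> 'oa \<Rightarrow> 'ab"

locale smf_typing =
  fixes A :: "('oa, 'aa) smcat" and C :: "('oc, 'ac) smcat"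
    and F :: "('oa, 'aa, 'oc, 'ac) smf"
  assumes fob_Ob: "x \<in> Ob A \<Longrightarrow> fob F x \<in> Ob C"
    and far_Hom: "f \<in> Hom A x y \<Longrightarrow> far F f \<in> Hom C (fob F x) (fob F y)"
    and fzero_Hom: "fzero F \<in> Hom C (unit_ob C) (fob F (unit_ob A))"
    and ftwo_Hom: "x \<in> Ob A \<Longrightarrow> y \<in> Ob A \<Longrightarrow>
          ftwo F x y \<in> Hom C (fob F x \<otimes>\<^bsub>C\<^esub> fob F y) (fob F (x \<otimes>\<^bsub>A\<^esub> y))"

locale smf_laws =
  fixes A :: "('oa, 'aa) smcat" and C :: "('oc, 'ac) smcat"
    and eq :: "'ac \<Rightarrow> 'ac \<Rightarrow> bool" (infix "\<approx>" 50)
    and F :: "('oa, 'aa, 'oc, 'ac) smf"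
  assumes far_idn: "x \<in> Ob A \<Longrightarrow> far F (idn A x) \<approx> idn C (fob F x)"
    and far_cmp: "f \<in> Hom A x y \<Longrightarrow> g \<in> Hom A y z \<Longrightarrow>
          far F (g \<cdot>\<^bsub>A\<^esub> f) \<approx> far F g \<cdot>\<^bsub>C\<^esub> far F f"
    and ftwo_nat: "f \<in> Hom A x x' \<Longrightarrow> g \<in> Hom A y y' \<Longrightarrow>
          ftwo F x' y' \<cdot>\<^bsub>C\<^esub> (far F f \<boxtimes>\<^bsub>C\<^esub> far F g) \<approx> far F (f \<boxtimes>\<^bsub>A\<^esub> g) \<cdot>\<^bsub>C\<^esub> ftwo F x y"
    and ftwo_ass: "x \<in> Ob A \<Longrightarrow> y \<in> Ob A \<Longrightarrow> z \<in> Ob A \<Longrightarrow>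
          far F (ass A x y z) \<cdot>\<^bsub>C\<^esub>
            (ftwo F x (y \<otimes>\<^bsub>A\<^esub> z) \<cdot>\<^bsub>C\<^esub> (idn C (fob F x) \<boxtimes>\<^bsub>C\<^esub> ftwo F y z)) \<approx>
          ftwo F (x \<otimes>\<^bsub>A\<^esub> y) z \<cdot>\<^bsub>C\<^esub>
            ((ftwo F x y \<boxtimes>\<^bsub>C\<^esub> idn C (fob F z)) \<cdot>\<^bsub>C\<^esub> ass C (fob F x) (fob F y) (fob F z))"
    and ftwo_runit: "x \<in> Ob A \<Longrightarrow>
          far F (runit A x) \<cdot>\<^bsub>C\<^esub>
            (ftwo F x (unit_ob A) \<cdot>\<^bsub>C\<^esub> (idn C (fob F x) \<boxtimes>\<^bsub>C\<^esub> fzero F)) \<approx>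
          runit C (fob F x)"
    and ftwo_lunit: "x \<in> Ob A \<Longrightarrow>
          far F (lunit A x) \<cdot>\<^bsub>C\<^esub>
            (ftwo F (unit_ob A) x \<cdot>\<^bsub>C\<^esub> (fzero F \<boxtimes>\<^bsub>C\<^esub> idn C (fob F x))) \<approx>
          lunit C (fob F x)"
    and ftwo_symm: "x \<in> Ob A \<Longrightarrow> y \<in> Ob A \<Longrightarrow>
          far F (symm A x y) \<cdot>\<^bsub>C\<^esub> ftwo F x y \<approx> ftwo F y x \<cdot>\<^bsub>C\<^esub> symm C (fob F x) (fob F y)"

text \<open>
  Functors and transformations take the value \<open>undefined\<close> outside their domains, so that HOL
  equality of these records is equality of functors and of transformations.
\<close>

definition symmetric_monoidal_functor ::
  "('oa, 'aa) smcat \<Rightarrow> ('oc, 'ac) smcat \<Rightarrow> ('oa, 'aa, 'oc, 'ac) smf \<Rightarrow> bool" where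
  "symmetric_monoidal_functor A C F \<longleftrightarrow>
     smf_typing A C F \<and> smf_laws A C (=) F \<and>
     fob F \<in> extensional (Ob A) \<and> far F \<in> extensional (Ar A) \<and>
     ftwo F \<in> extensional (Ob A) \<and> (\<forall>x\<in>Ob A. ftwo F x \<in> extensional (Ob A))"

definition strict_smf :: "('oa, 'aa) smcat \<Rightarrow> ('oc, 'ac) smcat \<Rightarrow>
    ('oa \<Rightarrow> 'oc) \<Rightarrow> ('aa \<Rightarrow> 'ac) \<Rightarrow> ('oa, 'aa, 'oc, 'ac) smf" where
  "strict_smf A C ob ar =
     \<lparr>fob = (\<lambda>x\<in>Ob A. ob x),
      far = (\<lambda>f\<in>Ar A. ar f),
      fzero = idn C (unit_ob C),
      ftwo = (\<lambda>x\<in>Ob A. \<lambda>y\<in>Ob A. idn C (ob x \<otimes>\<^bsub>C\<^esub> ob y))\<rparr>"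

definition smf_id :: "('oa, 'aa) smcat \<Rightarrow> ('oa, 'aa, 'oa, 'aa) smf" where
  "smf_id A =
     \<lparr>fob = (\<lambda>x\<in>Ob A. x),
      far = (\<lambda>f\<in>Ar A. f),
      fzero = idn A (unit_ob A),
      ftwo = (\<lambda>x\<in>Ob A. \<lambda>y\<in>Ob A. idn A (x \<otimes>\<^bsub>A\<^esub> y))\<rparr>"

text \<open>\<open>smf_comp A C G F\<close> is the composite in SMC of \<open>F\<close> from \<open>A\<close> to some \<open>B\<close> with \<open>G\<close> from \<open>B\<close> to \<open>C\<close>.\<close>

definition smf_comp :: "('oa, 'aa) smcat \<Rightarrow> ('oc, 'ac) smcat \<Rightarrow>
    ('ob, 'ab, 'oc, 'ac) smf \<Rightarrow> ('oa, 'aa, 'ob, 'ab) smf \<Rightarrow> ('oa, 'aa, 'oc, 'ac) smf" where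
  "smf_comp A C G F =
     \<lparr>fob = (\<lambda>x\<in>Ob A. fob G (fob F x)),
      far = (\<lambda>f\<in>Ar A. far G (far F f)),
      fzero = far G (fzero F) \<cdot>\<^bsub>C\<^esub> fzero G,
      ftwo = (\<lambda>x\<in>Ob A. \<lambda>y\<in>Ob A. far G (ftwo F x y) \<cdot>\<^bsub>C\<^esub> ftwo G (fob F x) (fob F y))\<rparr>"

record ('oa, 'aa, 'oc, 'ac) mnt =
  msrc :: "('oa, 'aa, 'oc, 'ac) smf"
  mtgt :: "('oa, 'aa, 'oc, 'ac) smf"
  mcomp :: "'oa \<Rightarrow> 'ac"

locale mnt_laws =
  fixes A :: "('oa, 'aa) smcat" and C :: "('oc, 'ac) smcat"
    and eq :: "'ac \<Rightarrow> 'ac \<Rightarrow> bool" (infix "\<approx>" 50)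
    and F G :: "('oa, 'aa, 'oc, 'ac) smf"
    and \<sigma> :: "'oa \<Rightarrow> 'ac"
  assumes naturality: "f \<in> Hom A x y \<Longrightarrow> \<sigma> y \<cdot>\<^bsub>C\<^esub> far F f \<approx> far G f \<cdot>\<^bsub>C\<^esub> \<sigma> x"
    and monoidal_zero: "\<sigma> (unit_ob A) \<cdot>\<^bsub>C\<^esub> fzero F \<approx> fzero G"
    and monoidal_two: "x \<in> Ob A \<Longrightarrow> y \<in> Ob A \<Longrightarrow>
          \<sigma> (x \<otimes>\<^bsub>A\<^esub> y) \<cdot>\<^bsub>C\<^esub> ftwo F x y \<approx> ftwo G x y \<cdot>\<^bsub>C\<^esub> (\<sigma> x \<boxtimes>\<^bsub>C\<^esub> \<sigma> y)"

definition monoidal_nat_trans ::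
  "('oa, 'aa) smcat \<Rightarrow> ('oc, 'ac) smcat \<Rightarrow> ('oa, 'aa, 'oc, 'ac) mnt \<Rightarrow> bool" where
  "monoidal_nat_trans A C \<sigma> \<longleftrightarrow>
     symmetric_monoidal_functor A C (msrc \<sigma>) \<and> symmetric_monoidal_functor A C (mtgt \<sigma>) \<and>
     (\<forall>x\<in>Ob A. mcomp \<sigma> x \<in> Hom C (fob (msrc \<sigma>) x) (fob (mtgt \<sigma>) x)) \<and>
     mnt_laws A C (=) (msrc \<sigma>) (mtgt \<sigma>) (mcomp \<sigma>) \<and>
     mcomp \<sigma> \<in> extensional (Ob A)"


section \<open>The internal hom and duality\<close>

definition box :: "('oa, 'aa) smcat \<Rightarrow> ('oc, 'ac) smcat \<Rightarrow>
    ('oa, 'aa, 'oc, 'ac) smf \<Rightarrow> ('oa, 'aa, 'oc, 'ac) smf \<Rightarrow> ('oa, 'aa, 'oc, 'ac) smf" where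
  "box A C F G =
     \<lparr>fob = (\<lambda>x\<in>Ob A. fob F x \<otimes>\<^bsub>C\<^esub> fob G x),
      far = (\<lambda>f\<in>Ar A. far F f \<boxtimes>\<^bsub>C\<^esub> far G f),
      fzero = (fzero F \<boxtimes>\<^bsub>C\<^esub> fzero G) \<cdot>\<^bsub>C\<^esub> runit_inv C (unit_ob C),
      ftwo = (\<lambda>x\<in>Ob A. \<lambda>y\<in>Ob A. (ftwo F x y \<boxtimes>\<^bsub>C\<^esub> ftwo G x y) \<cdot>\<^bsub>C\<^esub>
                interchange C (fob F x) (fob G x) (fob F y) (fob G y))\<rparr>"

text \<open>The canonical arrow \<open>I \<otimes> I \<rightarrow> I\<close> is taken to be \<open>runit\<close> at \<open>I\<close>, which equals \<open>lunit\<close> at \<open>I\<close>.\<close>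

definition const_unit :: "('oa, 'aa) smcat \<Rightarrow> ('oc, 'ac) smcat \<Rightarrow> ('oa, 'aa, 'oc, 'ac) smf" where
  "const_unit A C =
     \<lparr>fob = (\<lambda>x\<in>Ob A. unit_ob C),
      far = (\<lambda>f\<in>Ar A. idn C (unit_ob C)),
      fzero = idn C (unit_ob C),
      ftwo = (\<lambda>x\<in>Ob A. \<lambda>y\<in>Ob A. runit C (unit_ob C))\<rparr>"

definition internal_hom :: "('oa, 'aa) smcat \<Rightarrow> ('oc, 'ac) smcat \<Rightarrow>
    (('oa, 'aa, 'oc, 'ac) smf, ('oa, 'aa, 'oc, 'ac) mnt) smcat" where
  "internal_hom A C =
     \<lparr>Ob = {F. symmetric_monoidal_functor A C F},
      Ar = {\<sigma>. monoidal_nat_trans A C \<sigma>},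
      Dom = msrc,
      Cod = mtgt,
      idn = (\<lambda>F. \<lparr>msrc = F, mtgt = F, mcomp = \<lambda>x\<in>Ob A. idn C (fob F x)\<rparr>),
      cmp = (\<lambda>\<tau> \<sigma>. \<lparr>msrc = msrc \<sigma>, mtgt = mtgt \<tau>,
               mcomp = \<lambda>x\<in>Ob A. mcomp \<tau> x \<cdot>\<^bsub>C\<^esub> mcomp \<sigma> x\<rparr>),
      unit_ob = const_unit A C,
      ten_ob = box A C,
      ten_ar = (\<lambda>\<sigma> \<tau>. \<lparr>msrc = box A C (msrc \<sigma>) (msrc \<tau>), mtgt = box A C (mtgt \<sigma>) (mtgt \<tau>),
               mcomp = \<lambda>x\<in>Ob A. mcomp \<sigma> x \<boxtimes>\<^bsub>C\<^esub> mcomp \<tau> x\<rparr>),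
      ass = (\<lambda>F G H. \<lparr>msrc = box A C F (box A C G H), mtgt = box A C (box A C F G) H,
               mcomp = \<lambda>x\<in>Ob A. ass C (fob F x) (fob G x) (fob H x)\<rparr>),
      ass_inv = (\<lambda>F G H. \<lparr>msrc = box A C (box A C F G) H, mtgt = box A C F (box A C G H),
               mcomp = \<lambda>x\<in>Ob A. ass_inv C (fob F x) (fob G x) (fob H x)\<rparr>),
      runit = (\<lambda>F. \<lparr>msrc = box A C F (const_unit A C), mtgt = F,
               mcomp = \<lambda>x\<in>Ob A. runit C (fob F x)\<rparr>),
      runit_inv = (\<lambda>F. \<lparr>msrc = F, mtgt = box A C F (const_unit A C),
               mcomp = \<lambda>x\<in>Ob A. runit_inv C (fob F x)\<rparr>),
      lunit = (\<lambda>F. \<lparr>msrc = box A C (const_unit A C) F, mtgt = F,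
               mcomp = \<lambda>x\<in>Ob A. lunit C (fob F x)\<rparr>),
      lunit_inv = (\<lambda>F. \<lparr>msrc = F, mtgt = box A C (const_unit A C) F,
               mcomp = \<lambda>x\<in>Ob A. lunit_inv C (fob F x)\<rparr>),
      symm = (\<lambda>F G. \<lparr>msrc = box A C F G, mtgt = box A C G F,
               mcomp = \<lambda>x\<in>Ob A. symm C (fob F x) (fob G x)\<rparr>)\<rparr>"

definition dual_ob :: "('oa, 'aa) smcat \<Rightarrow>
    ('oa, 'aa, ('ob, 'ab, 'oc, 'ac) smf, ('ob, 'ab, 'oc, 'ac) mnt) smf \<Rightarrow> 'ob \<Rightarrow>
    ('oa, 'aa, 'oc, 'ac) smf" where
  "dual_ob A F b =
     \<lparr>fob = (\<lambda>a\<in>Ob A. fob (fob F a) b),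
      far = (\<lambda>f\<in>Ar A. mcomp (far F f) b),
      fzero = mcomp (fzero F) b,
      ftwo = (\<lambda>a\<in>Ob A. \<lambda>a'\<in>Ob A. mcomp (ftwo F a a') b)\<rparr>"

definition dual :: "('oa, 'aa) smcat \<Rightarrow> ('ob, 'ab) smcat \<Rightarrow> ('oc, 'ac) smcat \<Rightarrow>
    ('oa, 'aa, ('ob, 'ab, 'oc, 'ac) smf, ('ob, 'ab, 'oc, 'ac) mnt) smf \<Rightarrow>
    ('ob, 'ab, ('oa, 'aa, 'oc, 'ac) smf, ('oa, 'aa, 'oc, 'ac) mnt) smf" where
  "dual A B C F =
     \<lparr>fob = (\<lambda>b\<in>Ob B. dual_ob A F b),
      far = (\<lambda>g\<in>Ar B. \<lparr>msrc = dual_ob A F (Dom B g), mtgt = dual_ob A F (Cod B g),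
               mcomp = \<lambda>a\<in>Ob A. far (fob F a) g\<rparr>),
      fzero = \<lparr>msrc = unit_ob (internal_hom A C), mtgt = dual_ob A F (unit_ob B),
               mcomp = \<lambda>a\<in>Ob A. fzero (fob F a)\<rparr>,
      ftwo = (\<lambda>b\<in>Ob B. \<lambda>b'\<in>Ob B.
               \<lparr>msrc = dual_ob A F b \<otimes>\<^bsub>internal_hom A C\<^esub> dual_ob A F b',
                mtgt = dual_ob A F (b \<otimes>\<^bsub>B\<^esub> b'),
                mcomp = \<lambda>a\<in>Ob A. ftwo (fob F a) b b'\<rparr>)\<rparr>"


section \<open>The tensor product\<close>

subsection \<open>Words and formal arrows\<close>

datatype ('oa, 'ob) word =
    WUnit
  | WSym 'oa 'ob
  | WTen "('oa, 'ob) word" "('oa, 'ob) word"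

primrec word_ok :: "('oa, 'aa) smcat \<Rightarrow> ('ob, 'ab) smcat \<Rightarrow> ('oa, 'ob) word \<Rightarrow> bool" where
  "word_ok A B WUnit \<longleftrightarrow> True"
| "word_ok A B (WSym a b) \<longleftrightarrow> a \<in> Ob A \<and> b \<in> Ob B"
| "word_ok A B (WTen X Y) \<longleftrightarrow> word_ok A B X \<and> word_ok A B Y"

text \<open>\<open>TCmp q p\<close> is \<open>q\<close> after \<open>p\<close>; \<open>TLeft X p\<close> is \<open>X \<otimes> p\<close> and \<open>TRight p X\<close> is \<open>p \<otimes> X\<close>.\<close>

datatype ('oa, 'aa, 'ob, 'ab) arr_term =
    TIdn "('oa, 'ob) word"
  | TCmp "('oa, 'aa, 'ob, 'ab) arr_term" "('oa, 'aa, 'ob, 'ab) arr_term"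
  | TLeft "('oa, 'ob) word" "('oa, 'aa, 'ob, 'ab) arr_term"
  | TRight "('oa, 'aa, 'ob, 'ab) arr_term" "('oa, 'ob) word"
  | TAss "('oa, 'ob) word" "('oa, 'ob) word" "('oa, 'ob) word"
  | TAssInv "('oa, 'ob) word" "('oa, 'ob) word" "('oa, 'ob) word"
  | TRunit "('oa, 'ob) word"
  | TRunitInv "('oa, 'ob) word"
  | TLunit "('oa, 'ob) word"
  | TLunitInv "('oa, 'ob) word"
  | TSymm "('oa, 'ob) word" "('oa, 'ob) word"
  | TAlpha 'ob
  | TBeta 'oa
  | TGamma 'oa 'oa 'ob
  | TDelta 'oa 'ob 'ob
  | TObAr 'oa 'ab  \<comment> \<open>\<open>a \<otimes> g\<close>\<close>
  | TArOb 'aa 'ob  \<comment> \<open>\<open>f \<otimes> b\<close>\<close>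

primrec term_dom :: "('oa, 'aa) smcat \<Rightarrow> ('ob, 'ab) smcat \<Rightarrow>
    ('oa, 'aa, 'ob, 'ab) arr_term \<Rightarrow> ('oa, 'ob) word" where
  "term_dom A B (TIdn X) = X"
| "term_dom A B (TCmp q p) = term_dom A B p"
| "term_dom A B (TLeft X p) = WTen X (term_dom A B p)"
| "term_dom A B (TRight p X) = WTen (term_dom A B p) X"
| "term_dom A B (TAss X Y Z) = WTen X (WTen Y Z)"
| "term_dom A B (TAssInv X Y Z) = WTen (WTen X Y) Z"
| "term_dom A B (TRunit X) = WTen X WUnit"
| "term_dom A B (TRunitInv X) = X"
| "term_dom A B (TLunit X) = WTen WUnit X"
| "term_dom A B (TLunitInv X) = X"
| "term_dom A B (TSymm X Y) = WTen X Y"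
| "term_dom A B (TAlpha b) = WUnit"
| "term_dom A B (TBeta a) = WUnit"
| "term_dom A B (TGamma a a' b) = WTen (WSym a b) (WSym a' b)"
| "term_dom A B (TDelta a b b') = WTen (WSym a b) (WSym a b')"
| "term_dom A B (TObAr a g) = WSym a (Dom B g)"
| "term_dom A B (TArOb f b) = WSym (Dom A f) b"

primrec term_cod :: "('oa, 'aa) smcat \<Rightarrow> ('ob, 'ab) smcat \<Rightarrow>
    ('oa, 'aa, 'ob, 'ab) arr_term \<Rightarrow> ('oa, 'ob) word" where
  "term_cod A B (TIdn X) = X"
| "term_cod A B (TCmp q p) = term_cod A B q"
| "term_cod A B (TLeft X p) = WTen X (term_cod A B p)"
| "term_cod A B (TRight p X) = WTen (term_cod A B p) X"
| "term_cod A B (TAss X Y Z) = WTen (WTen X Y) Z"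
| "term_cod A B (TAssInv X Y Z) = WTen X (WTen Y Z)"
| "term_cod A B (TRunit X) = X"
| "term_cod A B (TRunitInv X) = WTen X WUnit"
| "term_cod A B (TLunit X) = X"
| "term_cod A B (TLunitInv X) = WTen WUnit X"
| "term_cod A B (TSymm X Y) = WTen Y X"
| "term_cod A B (TAlpha b) = WSym (unit_ob A) b"
| "term_cod A B (TBeta a) = WSym a (unit_ob B)"
| "term_cod A B (TGamma a a' b) = WSym (a \<otimes>\<^bsub>A\<^esub> a') b"
| "term_cod A B (TDelta a b b') = WSym a (b \<otimes>\<^bsub>B\<^esub> b')"
| "term_cod A B (TObAr a g) = WSym a (Cod B g)"
| "term_cod A B (TArOb f b) = WSym (Cod A f) b"

primrec term_ok :: "('oa, 'aa) smcat \<Rightarrow> ('ob, 'ab) smcat \<Rightarrow>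
    ('oa, 'aa, 'ob, 'ab) arr_term \<Rightarrow> bool" where
  "term_ok A B (TIdn X) \<longleftrightarrow> word_ok A B X"
| "term_ok A B (TCmp q p) \<longleftrightarrow> term_ok A B q \<and> term_ok A B p \<and> term_dom A B q = term_cod A B p"
| "term_ok A B (TLeft X p) \<longleftrightarrow> word_ok A B X \<and> term_ok A B p"
| "term_ok A B (TRight p X) \<longleftrightarrow> term_ok A B p \<and> word_ok A B X"
| "term_ok A B (TAss X Y Z) \<longleftrightarrow> word_ok A B X \<and> word_ok A B Y \<and> word_ok A B Z"
| "term_ok A B (TAssInv X Y Z) \<longleftrightarrow> word_ok A B X \<and> word_ok A B Y \<and> word_ok A B Z"
| "term_ok A B (TRunit X) \<longleftrightarrow> word_ok A B X"
| "term_ok A B (TRunitInv X) \<longleftrightarrow> word_ok A B X"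
| "term_ok A B (TLunit X) \<longleftrightarrow> word_ok A B X"
| "term_ok A B (TLunitInv X) \<longleftrightarrow> word_ok A B X"
| "term_ok A B (TSymm X Y) \<longleftrightarrow> word_ok A B X \<and> word_ok A B Y"
| "term_ok A B (TAlpha b) \<longleftrightarrow> b \<in> Ob B"
| "term_ok A B (TBeta a) \<longleftrightarrow> a \<in> Ob A"
| "term_ok A B (TGamma a a' b) \<longleftrightarrow> a \<in> Ob A \<and> a' \<in> Ob A \<and> b \<in> Ob B"
| "term_ok A B (TDelta a b b') \<longleftrightarrow> a \<in> Ob A \<and> b \<in> Ob B \<and> b' \<in> Ob B"
| "term_ok A B (TObAr a g) \<longleftrightarrow> a \<in> Ob A \<and> g \<in> Ar B"
| "term_ok A B (TArOb f b) \<longleftrightarrow> f \<in> Ar A \<and> b \<in> Ob B"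

text \<open>
  The formal arrows with their operations. This is not yet a category: the laws only hold up to the
  congruence below. The tensor of two arrows is derived from the two one-sided operations.
\<close>

definition formal :: "('oa, 'aa) smcat \<Rightarrow> ('ob, 'ab) smcat \<Rightarrow>
    (('oa, 'ob) word, ('oa, 'aa, 'ob, 'ab) arr_term) smcat" where
  "formal A B =
     \<lparr>Ob = {X. word_ok A B X},
      Ar = {p. term_ok A B p},
      Dom = term_dom A B,
      Cod = term_cod A B,
      idn = TIdn,
      cmp = TCmp,
      unit_ob = WUnit,
      ten_ob = WTen,
      ten_ar = (\<lambda>p q. TCmp (TRight p (term_cod A B q)) (TLeft (term_dom A B p) q)),
      ass = TAss,
      ass_inv = TAssInv,
      runit = TRunit,
      runit_inv = TRunitInv,
      lunit = TLunit,
      lunit_inv = TLunitInv,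
      symm = TSymm\<rparr>"

definition formal_left :: "'oa \<Rightarrow> ('ob, 'ab, ('oa, 'ob) word, ('oa, 'aa, 'ob, 'ab) arr_term) smf" where
  "formal_left a = \<lparr>fob = WSym a, far = TObAr a, fzero = TBeta a, ftwo = TDelta a\<rparr>"

definition formal_right :: "'ob \<Rightarrow> ('oa, 'aa, ('oa, 'ob) word, ('oa, 'aa, 'ob, 'ab) arr_term) smf" where
  "formal_right b = \<lparr>fob = (\<lambda>a. WSym a b), far = (\<lambda>f. TArOb f b), fzero = TAlpha b,
                     ftwo = (\<lambda>a a'. TGamma a a' b)\<rparr>"

subsection \<open>The congruence\<close>

locale tensor_congruence =
  fixes A :: "('oa, 'aa) smcat" and B :: "('ob, 'ab) smcat"
    and eq :: "('oa, 'aa, 'ob, 'ab) arr_term \<Rightarrow> ('oa, 'aa, 'ob, 'ab) arr_term \<Rightarrow> bool" (infix "\<approx>" 50)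
  assumes equiv: "equiv (Ar (formal A B)) {(p, q). p \<approx> q}"
    and parallel: "p \<approx> q \<Longrightarrow> term_dom A B p = term_dom A B q \<and> term_cod A B p = term_cod A B q"
    and cong_cmp: "p \<approx> p' \<Longrightarrow> q \<approx> q' \<Longrightarrow> term_dom A B q = term_cod A B p \<Longrightarrow> TCmp q p \<approx> TCmp q' p'"
    and cong_left: "word_ok A B X \<Longrightarrow> p \<approx> p' \<Longrightarrow> TLeft X p \<approx> TLeft X p'"
    and cong_right: "word_ok A B X \<Longrightarrow> p \<approx> p' \<Longrightarrow> TRight p X \<approx> TRight p' X"
    \<comment> \<open>bifunctoriality of \<open>\<otimes>\<close>, in terms of the one-sided operations\<close>
    and left_idn: "word_ok A B X \<Longrightarrow> word_ok A B Y \<Longrightarrow> TLeft X (TIdn Y) \<approx> TIdn (WTen X Y)"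
    and left_cmp: "word_ok A B X \<Longrightarrow> term_ok A B (TCmp q p) \<Longrightarrow>
          TLeft X (TCmp q p) \<approx> TCmp (TLeft X q) (TLeft X p)"
    and right_idn: "word_ok A B X \<Longrightarrow> word_ok A B Y \<Longrightarrow> TRight (TIdn Y) X \<approx> TIdn (WTen Y X)"
    and right_cmp: "word_ok A B X \<Longrightarrow> term_ok A B (TCmp q p) \<Longrightarrow>
          TRight (TCmp q p) X \<approx> TCmp (TRight q X) (TRight p X)"
    and left_right: "term_ok A B p \<Longrightarrow> term_ok A B q \<Longrightarrow>
          TCmp (TRight p (term_cod A B q)) (TLeft (term_dom A B p) q) \<approx>
          TCmp (TLeft (term_cod A B p) q) (TRight p (term_dom A B q))"
    and smc: "smc_laws (formal A B) (\<approx>)"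
    and left_functor: "a \<in> Ob A \<Longrightarrow> smf_laws B (formal A B) (\<approx>) (formal_left a)"
    and right_functor: "b \<in> Ob B \<Longrightarrow> smf_laws A (formal A B) (\<approx>) (formal_right b)"
    and left_transformation: "f \<in> Hom A a a' \<Longrightarrow>
          mnt_laws B (formal A B) (\<approx>) (formal_left a) (formal_left a') (TArOb f)"
    and right_transformation: "g \<in> Hom B b b' \<Longrightarrow>
          mnt_laws A (formal A B) (\<approx>) (formal_right b) (formal_right b') (\<lambda>a. TObAr a g)"
    \<comment> \<open>the canonical arrow \<open>I \<otimes> I \<rightarrow> I\<close> is \<open>TRunit WUnit\<close>\<close>
    and alpha_delta: "b \<in> Ob B \<Longrightarrow> b' \<in> Ob B \<Longrightarrow>
          TCmp (TAlpha (b \<otimes>\<^bsub>B\<^esub> b')) (TRunit WUnit) \<approx>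
          TCmp (TDelta (unit_ob A) b b') (TAlpha b \<boxtimes>\<^bsub>formal A B\<^esub> TAlpha b')"
    and beta_gamma: "a \<in> Ob A \<Longrightarrow> a' \<in> Ob A \<Longrightarrow>
          TCmp (TBeta (a \<otimes>\<^bsub>A\<^esub> a')) (TRunit WUnit) \<approx>
          TCmp (TGamma a a' (unit_ob B)) (TBeta a \<boxtimes>\<^bsub>formal A B\<^esub> TBeta a')"
    and beta_alpha: "TBeta (unit_ob A) \<approx> TAlpha (unit_ob B)"
    and gamma_delta: "a \<in> Ob A \<Longrightarrow> a' \<in> Ob A \<Longrightarrow> b \<in> Ob B \<Longrightarrow> b' \<in> Ob B \<Longrightarrow>
          TCmp (TGamma a a' (b \<otimes>\<^bsub>B\<^esub> b')) (TDelta a b b' \<boxtimes>\<^bsub>formal A B\<^esub> TDelta a' b b') \<approx>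
          TCmp (TDelta (a \<otimes>\<^bsub>A\<^esub> a') b b')
            (TCmp (TGamma a a' b \<boxtimes>\<^bsub>formal A B\<^esub> TGamma a a' b')
              (interchange (formal A B) (WSym a b) (WSym a b') (WSym a' b) (WSym a' b')))"

text \<open>The smallest congruence: the locale assumptions are closed under intersection.\<close>

definition tensor_cong :: "('oa, 'aa) smcat \<Rightarrow> ('ob, 'ab) smcat \<Rightarrow>
    ('oa, 'aa, 'ob, 'ab) arr_term \<Rightarrow> ('oa, 'aa, 'ob, 'ab) arr_term \<Rightarrow> bool" where
  "tensor_cong A B p q \<longleftrightarrow> (\<forall>eq. tensor_congruence A B eq \<longrightarrow> eq p q)"

subsection \<open>The quotient\<close>

definition cls :: "('t \<Rightarrow> 't \<Rightarrow> bool) \<Rightarrow> 't \<Rightarrow> 't set" where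
  "cls eq p = {q. eq p q}"

definition rep :: "'t set \<Rightarrow> 't" where
  "rep c = (SOME p. p \<in> c)"

definition quotient_smc :: "('o, 't) smcat \<Rightarrow> ('t \<Rightarrow> 't \<Rightarrow> bool) \<Rightarrow> ('o, 't set) smcat" where
  "quotient_smc C eq =
     \<lparr>Ob = Ob C,
      Ar = Ar C // {(p, q). eq p q},
      Dom = (\<lambda>c. Dom C (rep c)),
      Cod = (\<lambda>c. Cod C (rep c)),
      idn = (\<lambda>x. cls eq (idn C x)),
      cmp = (\<lambda>d c. cls eq (rep d \<cdot>\<^bsub>C\<^esub> rep c)),
      unit_ob = unit_ob C,
      ten_ob = ten_ob C,
      ten_ar = (\<lambda>c d. cls eq (rep c \<boxtimes>\<^bsub>C\<^esub> rep d)),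
      ass = (\<lambda>x y z. cls eq (ass C x y z)),
      ass_inv = (\<lambda>x y z. cls eq (ass_inv C x y z)),
      runit = (\<lambda>x. cls eq (runit C x)),
      runit_inv = (\<lambda>x. cls eq (runit_inv C x)),
      lunit = (\<lambda>x. cls eq (lunit C x)),
      lunit_inv = (\<lambda>x. cls eq (lunit_inv C x)),
      symm = (\<lambda>x y. cls eq (symm C x y))\<rparr>"

definition tensor :: "('oa, 'aa) smcat \<Rightarrow> ('ob, 'ab) smcat \<Rightarrow>
    (('oa, 'ob) word, ('oa, 'aa, 'ob, 'ab) arr_term set) smcat" where
  "tensor A B = quotient_smc (formal A B) (tensor_cong A B)"

subsection \<open>The functor \<open>\<eta> : A \<rightarrow> [B, A \<otimes> B]\<close>\<close>

definition eta_ob :: "('oa, 'aa) smcat \<Rightarrow> ('ob, 'ab) smcat \<Rightarrow> 'oa \<Rightarrow>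
    ('ob, 'ab, ('oa, 'ob) word, ('oa, 'aa, 'ob, 'ab) arr_term set) smf" where
  "eta_ob A B a =
     \<lparr>fob = (\<lambda>b\<in>Ob B. WSym a b),
      far = (\<lambda>g\<in>Ar B. cls (tensor_cong A B) (TObAr a g)),
      fzero = cls (tensor_cong A B) (TBeta a),
      ftwo = (\<lambda>b\<in>Ob B. \<lambda>b'\<in>Ob B. cls (tensor_cong A B) (TDelta a b b'))\<rparr>"

definition eta :: "('oa, 'aa) smcat \<Rightarrow> ('ob, 'ab) smcat \<Rightarrow>
    ('oa, 'aa,
     ('ob, 'ab, ('oa, 'ob) word, ('oa, 'aa, 'ob, 'ab) arr_term set) smf,
     ('ob, 'ab, ('oa, 'ob) word, ('oa, 'aa, 'ob, 'ab) arr_term set) mnt) smf" where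
  "eta A B =
     \<lparr>fob = (\<lambda>a\<in>Ob A. eta_ob A B a),
      far = (\<lambda>f\<in>Ar A. \<lparr>msrc = eta_ob A B (Dom A f), mtgt = eta_ob A B (Cod A f),
               mcomp = \<lambda>b\<in>Ob B. cls (tensor_cong A B) (TArOb f b)\<rparr>),
      fzero = \<lparr>msrc = unit_ob (internal_hom B (tensor A B)), mtgt = eta_ob A B (unit_ob A),
               mcomp = \<lambda>b\<in>Ob B. cls (tensor_cong A B) (TAlpha b)\<rparr>,
      ftwo = (\<lambda>a\<in>Ob A. \<lambda>a'\<in>Ob A.
               \<lparr>msrc = eta_ob A B a \<otimes>\<^bsub>internal_hom B (tensor A B)\<^esub> eta_ob A B a',
                mtgt = eta_ob A B (a \<otimes>\<^bsub>A\<^esub> a'),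
                mcomp = \<lambda>b\<in>Ob B. cls (tensor_cong A B) (TGamma a a' b)\<rparr>)\<rparr>"


section \<open>\<open>En\<close> and the symmetry \<open>S\<close>\<close>

primrec en_word :: "('oc, 'ac) smcat \<Rightarrow>
    ('oa, 'aa, ('ob, 'ab, 'oc, 'ac) smf, ('ob, 'ab, 'oc, 'ac) mnt) smf \<Rightarrow>
    ('oa, 'ob) word \<Rightarrow> 'oc" where
  "en_word C F WUnit = unit_ob C"
| "en_word C F (WSym a b) = fob (fob F a) b"
| "en_word C F (WTen X Y) = en_word C F X \<otimes>\<^bsub>C\<^esub> en_word C F Y"

primrec en_term :: "('oc, 'ac) smcat \<Rightarrow>
    ('oa, 'aa, ('ob, 'ab, 'oc, 'ac) smf, ('ob, 'ab, 'oc, 'ac) mnt) smf \<Rightarrow>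
    ('oa, 'aa, 'ob, 'ab) arr_term \<Rightarrow> 'ac" where
  "en_term C F (TIdn X) = idn C (en_word C F X)"
| "en_term C F (TCmp q p) = en_term C F q \<cdot>\<^bsub>C\<^esub> en_term C F p"
| "en_term C F (TLeft X p) = idn C (en_word C F X) \<boxtimes>\<^bsub>C\<^esub> en_term C F p"
| "en_term C F (TRight p X) = en_term C F p \<boxtimes>\<^bsub>C\<^esub> idn C (en_word C F X)"
| "en_term C F (TAss X Y Z) = ass C (en_word C F X) (en_word C F Y) (en_word C F Z)"
| "en_term C F (TAssInv X Y Z) = ass_inv C (en_word C F X) (en_word C F Y) (en_word C F Z)"
| "en_term C F (TRunit X) = runit C (en_word C F X)"
| "en_term C F (TRunitInv X) = runit_inv C (en_word C F X)"
| "en_term C F (TLunit X) = lunit C (en_word C F X)"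
| "en_term C F (TLunitInv X) = lunit_inv C (en_word C F X)"
| "en_term C F (TSymm X Y) = symm C (en_word C F X) (en_word C F Y)"
| "en_term C F (TAlpha b) = mcomp (fzero F) b"
| "en_term C F (TBeta a) = fzero (fob F a)"
| "en_term C F (TGamma a a' b) = mcomp (ftwo F a a') b"
| "en_term C F (TDelta a b b') = ftwo (fob F a) b b'"
| "en_term C F (TObAr a g) = far (fob F a) g"
| "en_term C F (TArOb f b) = mcomp (far F f) b"

text \<open>
  On arrows \<open>En F\<close> evaluates a representative. The value does not depend on the choice when \<open>F\<close> is a
  symmetric monoidal functor from \<open>A\<close> to \<open>[B, C]\<close>.
\<close>

definition En :: "('oa, 'aa) smcat \<Rightarrow> ('ob, 'ab) smcat \<Rightarrow> ('oc, 'ac) smcat \<Rightarrow>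
    ('oa, 'aa, ('ob, 'ab, 'oc, 'ac) smf, ('ob, 'ab, 'oc, 'ac) mnt) smf \<Rightarrow>
    (('oa, 'ob) word, ('oa, 'aa, 'ob, 'ab) arr_term set, 'oc, 'ac) smf" where
  "En A B C F = strict_smf (tensor A B) C (en_word C F) (\<lambda>c. en_term C F (rep c))"

definition S :: "('oa, 'aa) smcat \<Rightarrow> ('ob, 'ab) smcat \<Rightarrow>
    (('oa, 'ob) word, ('oa, 'aa, 'ob, 'ab) arr_term set,
     ('ob, 'oa) word, ('ob, 'ab, 'oa, 'aa) arr_term set) smf" where
  "S A B = En A B (tensor B A) (dual B A (tensor B A) (eta B A))"

end

theory Submission
  imports Defs
begin

text \<open>
  The presentation of \<open>A \<otimes> B\<close> is symmetric in the two factors: exchanging \<open>a \<otimes> b\<close> with \<open>b \<otimes> a\<close>,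
  \<open>\<alpha>\<close> with \<open>\<beta>\<close>, \<open>\<gamma>\<close> with \<open>\<delta>\<close> and \<open>a \<otimes> g\<close> with \<open>g \<otimes> a\<close>, and leaving the monoidal structure alone,
  turns formal arrows of \<open>A \<otimes> B\<close> into formal arrows of \<open>B \<otimes> A\<close>. This operation \<open>flip\<close> is an
  involution on the nose, and \<open>S\<close> is what it induces on classes. Indeed \<open>S = En(\<eta>\<^sup>*)\<close> evaluates a
  formal arrow generator by generator, and the dual \<open>\<eta>\<^sup>*\<close> supplies as value of each generator
  precisely the class of its mirror image (\<open>en_term_dual_eta\<close>). Hence the composite of the two
  symmetries sends the class of \<open>p\<close> to the class of \<open>flip (flip p) = p\<close>.

  What remains is that \<open>flip\<close> respects the congruences. Since \<open>tensor_cong\<close> is the least congruence,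
  it is enough that every congruence for \<open>B \<otimes> A\<close> pulls back along \<open>flip\<close> to a congruence for \<open>A \<otimes> B\<close>
  (\<open>tensor_congruence_flip\<close>). The defining relations come in mirror pairs, with one exception: the
  relation between \<open>\<gamma>\<close> and \<open>\<delta>\<close> is its own mirror image only up to moving the interchange isomorphism
  to the other side. So \<open>flip\<close> preserves it because the interchange of four factors, done twice, is
  the identity (\<open>interchange_interchange\<close>, \<open>delta_gamma\<close>).

  To compute with classes through chosen representatives one also needs that the intersection of
  all congruences is itself a congruence (\<open>tensor_congruence_tensor_cong\<close>). That its related arrows
  are well-formed and parallel is not automatic for an intersection, which would be the total
  relation if there were no congruence at all; it follows from the congruence that
  relates all parallel formal arrows (\<open>tensor_congruence_parallel\<close>).
\<close>

section \<open>Formal arrows\<close>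

lemma formal_simps [simp]:
  "Ob (formal A B) = {X. word_ok A B X}"
  "Ar (formal A B) = {p. term_ok A B p}"
  "Dom (formal A B) = term_dom A B"
  "Cod (formal A B) = term_cod A B"
  "idn (formal A B) = TIdn"
  "cmp (formal A B) = TCmp"
  "unit_ob (formal A B) = WUnit"
  "ten_ob (formal A B) = WTen"
  "ten_ar (formal A B) p q = TCmp (TRight p (term_cod A B q)) (TLeft (term_dom A B p) q)"
  "ass (formal A B) = TAss"
  "ass_inv (formal A B) = TAssInv"
  "runit (formal A B) = TRunit"
  "runit_inv (formal A B) = TRunitInv"
  "lunit (formal A B) = TLunit"
  "lunit_inv (formal A B) = TLunitInv"
  "symm (formal A B) = TSymm"
  by (simp_all add: formal_def)

lemma Hom_formal [simp]:
  "p \<in> Hom (formal A B) X Y \<longleftrightarrow> term_ok A B p \<and> term_dom A B p = X \<and> term_cod A B p = Y"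
  by (simp add: Hom_def)

lemma formal_left_simps [simp]:
  "fob (formal_left a) = WSym a" "far (formal_left a) = TObAr a"
  "fzero (formal_left a) = TBeta a" "ftwo (formal_left a) = TDelta a"
  by (simp_all add: formal_left_def)

lemma formal_right_simps [simp]:
  "fob (formal_right b) a = WSym a b" "far (formal_right b) f = TArOb f b"
  "fzero (formal_right b) = TAlpha b" "ftwo (formal_right b) a a' = TGamma a a' b"
  by (simp_all add: formal_right_def)

lemma (in smc_typing) Hom_facts:
  "f \<in> Hom C x y \<Longrightarrow> f \<in> Ar C \<and> Dom C f = x \<and> Cod C f = y \<and> x \<in> Ob C \<and> y \<in> Ob C"
  using Dom_Ob Cod_Ob by (auto simp: Hom_def)

lemma word_ok_dom_cod:
  assumes "smc_typing A" and "smc_typing B" and "term_ok A B p"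
  shows "word_ok A B (term_dom A B p) \<and> word_ok A B (term_cod A B p)"
proof -
  interpret A: smc_typing A by fact
  interpret B: smc_typing B by fact
  show ?thesis
    using assms(3)
    by (induction p)
      (simp_all add: A.Dom_Ob A.Cod_Ob B.Dom_Ob B.Cod_Ob A.unit_Ob B.unit_Ob A.ten_Ob B.ten_Ob)
qed

section \<open>Congruences\<close>

lemma interchange_Hom:
  assumes "word_ok A B X" "word_ok A B Y" "word_ok A B Z" "word_ok A B W"
  shows "interchange (formal A B) X Y Z W \<in>
    Hom (formal A B) (WTen (WTen X Y) (WTen Z W)) (WTen (WTen X Z) (WTen Y W))"
  using assms by (simp add: interchange_def)

context tensor_congruence
begin

lemma refl: "term_ok A B p \<Longrightarrow> p \<approx> p"
  using equiv by (auto simp: equiv_def refl_on_def)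

lemma sym: "p \<approx> q \<Longrightarrow> q \<approx> p"
  using equiv by (auto simp: equiv_def dest: symD)

lemma trans [trans]: "p \<approx> q \<Longrightarrow> q \<approx> r \<Longrightarrow> p \<approx> r"
  using equiv by (auto simp: equiv_def dest: transD)

lemma ok: "p \<approx> q \<Longrightarrow> term_ok A B p \<and> term_ok A B q"
  using equiv by (auto simp: equiv_def refl_on_def)

interpretation laws: smc_laws "formal A B" "(\<approx>)"
  by (rule smc)

lemma idn_left: "term_ok A B p \<Longrightarrow> term_cod A B p = Y \<Longrightarrow> TCmp (TIdn Y) p \<approx> p"
  using laws.idn_left[of p "term_dom A B p" Y] by simp

lemma idn_right: "term_ok A B p \<Longrightarrow> term_dom A B p = X \<Longrightarrow> TCmp p (TIdn X) \<approx> p"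
  using laws.idn_right[of p X "term_cod A B p"] by simp

lemma cmp_assoc: "term_ok A B (TCmp r (TCmp q p)) \<Longrightarrow> TCmp (TCmp r q) p \<approx> TCmp r (TCmp q p)"
  using laws.cmp_assoc[of p "term_dom A B p" "term_cod A B p" q "term_cod A B q" r "term_cod A B r"]
  by (simp add: sym)

text \<open>
  The next two lemmas cancel the right-nested composites of \<open>interchange\<close> factor by factor:
  \<open>cmp_on\<close> lets the factors of a composite act one after the other, and \<open>cancel\<close> is one such action.
\<close>

lemma cancel:
  assumes "term_ok A B (TCmp q' (TCmp q p))" and "TCmp q' q \<approx> TIdn X" and "term_cod A B p = X"
  shows "TCmp q' (TCmp q p) \<approx> p"
proof -
  have "TCmp q' (TCmp q p) \<approx> TCmp (TCmp q' q) p"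
    using assms(1) by (intro sym[OF cmp_assoc])
  also have "\<dots> \<approx> TCmp (TIdn X) p"
    using assms by (intro cong_cmp refl) auto
  also have "\<dots> \<approx> p"
    using assms by (intro idn_left) auto
  finally show ?thesis .
qed

lemma cmp_on:
  assumes "term_ok A B (TCmp (TCmp r q) p)" and "TCmp q p \<approx> p'" and "TCmp r p' \<approx> p''"
  shows "TCmp (TCmp r q) p \<approx> p''"
proof -
  have "TCmp (TCmp r q) p \<approx> TCmp r (TCmp q p)"
    using assms(1) by (intro cmp_assoc) auto
  also have "\<dots> \<approx> TCmp r p'"
    using assms by (intro cong_cmp refl) auto
  also note assms(3)
  finally show ?thesis .
qed

lemma ten_cong:
  assumes "p \<approx> p'" and "q \<approx> q'"
    and "word_ok A B (term_dom A B p)" and "word_ok A B (term_cod A B q)"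
  shows "p \<boxtimes>\<^bsub>formal A B\<^esub> q \<approx> p' \<boxtimes>\<^bsub>formal A B\<^esub> q'"
  using assms parallel[OF assms(1)] parallel[OF assms(2)]
  by (auto intro!: cong_cmp cong_left cong_right)

lemma ten_cancel:
  assumes "term_ok A B q" "term_ok A B q'" "term_ok A B p" "term_ok A B p'"
    and q: "TCmp q' q \<approx> TIdn X" and p: "TCmp p' p \<approx> TIdn Y"
    and "word_ok A B X" "word_ok A B Y"
  shows "TCmp (q' \<boxtimes>\<^bsub>formal A B\<^esub> p') (q \<boxtimes>\<^bsub>formal A B\<^esub> p) \<approx> TIdn (WTen X Y)"
proof -
  have t: "term_ok A B (TCmp q' q)" "term_ok A B (TCmp p' p)"
    using ok[OF q] ok[OF p] by auto
  have d: "term_dom A B q = X" "term_cod A B q' = X" "term_dom A B p = Y" "term_cod A B p' = Y"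
    using parallel[OF q] parallel[OF p] by auto
  have "TCmp (q' \<boxtimes>\<^bsub>formal A B\<^esub> p') (q \<boxtimes>\<^bsub>formal A B\<^esub> p) \<approx>
      TCmp q' q \<boxtimes>\<^bsub>formal A B\<^esub> TCmp p' p"
    using laws.ten_cmp[of q X "term_cod A B q" q' X p Y "term_cod A B p" p' Y] t d
    by (simp add: sym)
  also have "\<dots> \<approx> TIdn X \<boxtimes>\<^bsub>formal A B\<^esub> TIdn Y"
    using q p d assms(7,8) by (intro ten_cong) auto
  also have "\<dots> \<approx> TIdn (WTen X Y)"
    using laws.ten_idn[of X Y] assms(7,8) by simp
  finally show ?thesis .
qed

text \<open>
  Each of the five factors of one interchange is inverted by the factor of the other in the
  mirrored position, so the ten factors cancel from the middle outwards.
\<close>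

lemma interchange_interchange:
  assumes "word_ok A B X" "word_ok A B Y" "word_ok A B Z" "word_ok A B W"
  shows "TCmp (interchange (formal A B) X Z Y W) (interchange (formal A B) X Y Z W) \<approx>
         TIdn (WTen (WTen X Y) (WTen Z W))"
proof -
  have id: "TCmp (TIdn V) (TIdn V) \<approx> TIdn V" if "word_ok A B V" for V
    using that by (intro idn_left) auto
  have ass: "TCmp (TAss U V V') (TAssInv U V V') \<approx> TIdn (WTen (WTen U V) V')"
      "TCmp (TAssInv U V V') (TAss U V V') \<approx> TIdn (WTen U (WTen V V'))"
    if "word_ok A B U" "word_ok A B V" "word_ok A B V'" for U V V'
    using laws.ass_ass_inv[of U V V'] laws.ass_inv_ass[of U V V'] that by auto
  have symm: "TCmp (TSymm V U) (TSymm U V) \<approx> TIdn (WTen U V)"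
    if "word_ok A B U" "word_ok A B V" for U V
    using laws.symm_symm[of U V] that by auto
  let ?t = "(\<boxtimes>\<^bsub>formal A B\<^esub>)"
  have 1: "TCmp (?t (TAssInv U V V') (TIdn W)) (?t (TAss U V V') (TIdn W)) \<approx>
        TIdn (WTen (WTen U (WTen V V')) W)"
     "TCmp (?t (TAss U V V') (TIdn W)) (?t (TAssInv U V V') (TIdn W)) \<approx>
        TIdn (WTen (WTen (WTen U V) V') W)"
    if "word_ok A B U" "word_ok A B V" "word_ok A B V'" for U V V'
    by (rule ten_cancel; use that assms in \<open>auto intro: ass id\<close>)+
  have 2: "TCmp (?t (?t (TIdn X) (TSymm Z Y)) (TIdn W)) (?t (?t (TIdn X) (TSymm Y Z)) (TIdn W)) \<approx>
        TIdn (WTen (WTen X (WTen Y Z)) W)"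
    by (rule ten_cancel[OF _ _ _ _ ten_cancel id]; use assms in \<open>auto intro: id symm\<close>)
  show ?thesis
    unfolding interchange_def formal_simps(5-8,10,11,16)
    (* The five factors of the left interchange act in turn, the innermost first. *)
    apply (rule cmp_on[OF _ cmp_on[OF _ cmp_on[OF _ cmp_on[OF _ cancel cancel] cancel] cancel] ass(2)])
    by (rule ass 1 2 | (use assms in simp))+
qed

text \<open>
  This is the mirror image of the relation \<open>gamma_delta\<close>. It follows from \<open>gamma_delta\<close> by composing
  with the inverse of the interchange on the right.
\<close>

lemma delta_gamma:
  assumes "a \<in> Ob A" "a' \<in> Ob A" "b \<in> Ob B" "b' \<in> Ob B"
    and "a \<otimes>\<^bsub>A\<^esub> a' \<in> Ob A" "b \<otimes>\<^bsub>B\<^esub> b' \<in> Ob B"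
  shows "TCmp (TDelta (a \<otimes>\<^bsub>A\<^esub> a') b b') (TGamma a a' b \<boxtimes>\<^bsub>formal A B\<^esub> TGamma a a' b') \<approx>
    TCmp (TGamma a a' (b \<otimes>\<^bsub>B\<^esub> b'))
      (TCmp (TDelta a b b' \<boxtimes>\<^bsub>formal A B\<^esub> TDelta a' b b')
        (interchange (formal A B) (WSym a b) (WSym a' b) (WSym a b') (WSym a' b')))"
    (is "TCmp ?d ?p \<approx> TCmp ?g (TCmp ?q ?m')")
proof -
  let ?m = "interchange (formal A B) (WSym a b) (WSym a b') (WSym a' b) (WSym a' b')"
  have m: "?m \<in> Hom (formal A B) (WTen (WTen (WSym a b) (WSym a b')) (WTen (WSym a' b) (WSym a' b')))
      (WTen (WTen (WSym a b) (WSym a' b)) (WTen (WSym a b') (WSym a' b')))"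
    "?m' \<in> Hom (formal A B) (WTen (WTen (WSym a b) (WSym a' b)) (WTen (WSym a b') (WSym a' b')))
      (WTen (WTen (WSym a b) (WSym a b')) (WTen (WSym a' b) (WSym a' b')))"
    by (rule interchange_Hom; use assms in simp)+
  have "TCmp ?g (TCmp ?q ?m') \<approx> TCmp (TCmp ?g ?q) ?m'"
    using m assms by (intro sym[OF cmp_assoc]) auto
  also have "\<dots> \<approx> TCmp (TCmp ?d (TCmp ?p ?m)) ?m'"
    using m assms by (intro cong_cmp refl gamma_delta) auto
  also have "\<dots> \<approx> TCmp ?d ?p"
    by (rule cmp_on[OF _ cmp_on[OF _ interchange_interchange idn_right] refl]; use m assms in simp)
  finally show ?thesis
    by (rule sym)
qed

end

context smc_typing
begin

lemma Hom_D: "f \<in> Hom C x y \<Longrightarrow> f \<in> Ar C \<and> Dom C f = x \<and> Cod C f = y"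
  by (simp add: Hom_def)

lemma cmp_facts:
  "f \<in> Hom C x y \<Longrightarrow> g \<in> Hom C y z \<Longrightarrow>
    g \<cdot> f \<in> Ar C \<and> Dom C (g \<cdot> f) = x \<and> Cod C (g \<cdot> f) = z"
  by (rule Hom_D[OF cmp_Hom])

lemma ten_facts:
  "f \<in> Hom C x y \<Longrightarrow> g \<in> Hom C x' y' \<Longrightarrow>
    f \<boxtimes> g \<in> Ar C \<and> Dom C (f \<boxtimes> g) = x \<otimes> x' \<and> Cod C (f \<boxtimes> g) = y \<otimes> y'"
  by (rule Hom_D[OF ten_Hom])

lemmas arrow_facts = idn_Hom[THEN Hom_D] ass_Hom[THEN Hom_D] runit_Hom[THEN Hom_D]
  lunit_Hom[THEN Hom_D] symm_Hom[THEN Hom_D] Dom_Ob Cod_Ob unit_Ob ten_Ob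

end

text \<open>
  For this relation every law only says that its two sides are well-formed and parallel. It is the
  largest congruence.
\<close>

lemma tensor_congruence_parallel:
  assumes "smc_typing A" and "smc_typing B"
  shows "tensor_congruence A B (\<lambda>p q. term_ok A B p \<and> term_ok A B q \<and>
           term_dom A B p = term_dom A B q \<and> term_cod A B p = term_cod A B q)"
    (is "tensor_congruence A B ?eq")
proof -
  interpret A: smc_typing A by fact
  interpret B: smc_typing B by fact
  note ok = word_ok_dom_cod[OF assms]
  have smc: "smc_laws (formal A B) ?eq"
    by unfold_locales (simp_all add: ok)
  have left: "smf_laws B (formal A B) ?eq (formal_left a)" if a: "a \<in> Ob A" for a
  proof (unfold_locales, goal_cases)
    case (2 f x y g z)
    then show ?case using a B.cmp_facts[OF 2] B.Hom_facts[OF 2(1)] B.Hom_facts[OF 2(2)] by simp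
  next
    case (3 f x x' g y y')
    then show ?case using a B.ten_facts[OF 3] B.Hom_facts[OF 3(1)] B.Hom_facts[OF 3(2)] by simp
  qed (simp_all add: a B.arrow_facts)
  have right: "smf_laws A (formal A B) ?eq (formal_right b)" if b: "b \<in> Ob B" for b
  proof (unfold_locales, goal_cases)
    case (2 f x y g z)
    then show ?case using b A.cmp_facts[OF 2] A.Hom_facts[OF 2(1)] A.Hom_facts[OF 2(2)] by simp
  next
    case (3 f x x' g y y')
    then show ?case using b A.ten_facts[OF 3] A.Hom_facts[OF 3(1)] A.Hom_facts[OF 3(2)] by simp
  qed (simp_all add: b A.arrow_facts)
  have left_trans: "mnt_laws B (formal A B) ?eq (formal_left a) (formal_left a') (TArOb f)"
    if f: "f \<in> Hom A a a'" for f a a'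
    by unfold_locales (use A.Hom_facts[OF f] in \<open>auto simp: B.arrow_facts dest: B.Hom_facts\<close>)
  have right_trans: "mnt_laws A (formal A B) ?eq (formal_right b) (formal_right b') (\<lambda>a. TObAr a g)"
    if g: "g \<in> Hom B b b'" for g b b'
    by unfold_locales (use B.Hom_facts[OF g] in \<open>auto simp: A.arrow_facts dest: A.Hom_facts\<close>)
  show ?thesis
  proof (rule tensor_congruence.intro, goal_cases)
    case 1
    show ?case unfolding equiv_def refl_on_def sym_def trans_def by auto
  next case 11 then show ?case by (rule smc)
  next case 12 then show ?case by (rule left)
  next case 13 then show ?case by (rule right)
  next case 14 then show ?case by (rule left_trans)
  next case 15 then show ?case by (rule right_trans)
  qed (simp_all add: ok A.arrow_facts B.arrow_facts interchange_def)
qed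

text \<open>
  The equational axioms are Horn clauses in which the relation occurs only in the conclusion, so
  they pass to intersections.
\<close>

lemma smc_laws_inter:
  assumes "\<And>eq. K eq \<Longrightarrow> smc_laws C eq"
  shows "smc_laws C (\<lambda>p q. \<forall>eq. K eq \<longrightarrow> eq p q)"
proof (unfold_locales, goal_cases)
  case 1 show ?case by (intro allI impI, drule smc_laws.cmp_assoc[OF assms 1], assumption)
next
  case 2 show ?case by (intro allI impI, drule smc_laws.idn_left[OF assms 2], assumption)
next
  case 3 show ?case by (intro allI impI, drule smc_laws.idn_right[OF assms 3], assumption)
next
  case 4 show ?case by (intro allI impI, drule smc_laws.ten_idn[OF assms 4], assumption)
next
  case 5 show ?case by (intro allI impI, drule smc_laws.ten_cmp[OF assms 5], assumption)
next
  case 6 show ?case by (intro allI impI, drule smc_laws.ass_inv_ass[OF assms 6], assumption)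
next
  case 7 show ?case by (intro allI impI, drule smc_laws.ass_ass_inv[OF assms 7], assumption)
next
  case 8 show ?case by (intro allI impI, drule smc_laws.runit_inv_runit[OF assms 8], assumption)
next
  case 9 show ?case by (intro allI impI, drule smc_laws.runit_runit_inv[OF assms 9], assumption)
next
  case 10 show ?case by (intro allI impI, drule smc_laws.lunit_inv_lunit[OF assms 10], assumption)
next
  case 11 show ?case by (intro allI impI, drule smc_laws.lunit_lunit_inv[OF assms 11], assumption)
next
  case 12 show ?case by (intro allI impI, drule smc_laws.ass_nat[OF assms 12], assumption)
next
  case 13 show ?case by (intro allI impI, drule smc_laws.runit_nat[OF assms 13], assumption)
next
  case 14 show ?case by (intro allI impI, drule smc_laws.lunit_nat[OF assms 14], assumption)
next
  case 15 show ?case by (intro allI impI, drule smc_laws.symm_nat[OF assms 15], assumption)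
next
  case 16 show ?case by (intro allI impI, drule smc_laws.symm_symm[OF assms 16], assumption)
next
  case 17 show ?case by (intro allI impI, drule smc_laws.pentagon[OF assms 17], assumption)
next
  case 18 show ?case by (intro allI impI, drule smc_laws.triangle[OF assms 18], assumption)
next
  case 19 show ?case by (intro allI impI, drule smc_laws.hexagon[OF assms 19], assumption)
next
  case 20 show ?case by (intro allI impI, drule smc_laws.runit_symm[OF assms 20], assumption)
qed

lemma smf_laws_inter:
  assumes "\<And>eq. K eq \<Longrightarrow> smf_laws A C eq F"
  shows "smf_laws A C (\<lambda>p q. \<forall>eq. K eq \<longrightarrow> eq p q) F"
proof (unfold_locales, goal_cases)
  case 1 show ?case by (intro allI impI, drule smf_laws.far_idn[OF assms 1], assumption)
next
  case 2 show ?case by (intro allI impI, drule smf_laws.far_cmp[OF assms 2], assumption)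
next
  case 3 show ?case by (intro allI impI, drule smf_laws.ftwo_nat[OF assms 3], assumption)
next
  case 4 show ?case by (intro allI impI, drule smf_laws.ftwo_ass[OF assms 4], assumption)
next
  case 5 show ?case by (intro allI impI, drule smf_laws.ftwo_runit[OF assms 5], assumption)
next
  case 6 show ?case by (intro allI impI, drule smf_laws.ftwo_lunit[OF assms 6], assumption)
next
  case 7 show ?case by (intro allI impI, drule smf_laws.ftwo_symm[OF assms 7], assumption)
qed

lemma mnt_laws_inter:
  assumes "\<And>eq. K eq \<Longrightarrow> mnt_laws A C eq F G \<sigma>"
  shows "mnt_laws A C (\<lambda>p q. \<forall>eq. K eq \<longrightarrow> eq p q) F G \<sigma>"
proof (unfold_locales, goal_cases)
  case 1 show ?case by (intro allI impI, drule mnt_laws.naturality[OF assms 1], assumption)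
next
  case 2 show ?case by (intro allI impI, drule mnt_laws.monoidal_zero[OF assms], assumption)
next
  case 3 show ?case by (intro allI impI, drule mnt_laws.monoidal_two[OF assms 3], assumption)
qed

lemma tensor_congI: "(\<And>eq. tensor_congruence A B eq \<Longrightarrow> eq p q) \<Longrightarrow> tensor_cong A B p q"
  unfolding tensor_cong_def by iprover

lemma tensor_congD: "tensor_cong A B p q \<Longrightarrow> tensor_congruence A B eq \<Longrightarrow> eq p q"
  unfolding tensor_cong_def by (drule spec, drule mp)

text \<open>
  The clauses whose conclusion is that two arrows are related are Horn clauses, so the intersection
  satisfies them. The remaining demand, that related arrows be well-formed and parallel, is
  inherited from one member of the intersection, the congruence of \<open>tensor_congruence_parallel\<close>.
\<close>

lemma tensor_congruence_tensor_cong: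
  assumes "smc_typing A" and "smc_typing B"
  shows "tensor_congruence A B (tensor_cong A B)"
proof -
  have par: "term_ok A B p \<and> term_ok A B q \<and>
      term_dom A B p = term_dom A B q \<and> term_cod A B p = term_cod A B q"
    if "tensor_cong A B p q" for p q
    using tensor_congD[OF that tensor_congruence_parallel[OF assms]] .
  have refl: "tensor_cong A B p p" if "term_ok A B p" for p
    using that by (intro tensor_congI) (rule tensor_congruence.refl)
  have sym: "tensor_cong A B q p" if "tensor_cong A B p q" for p q
  proof (rule tensor_congI)
    fix eq assume K: "tensor_congruence A B eq"
    show "eq q p" by (rule tensor_congruence.sym[OF K tensor_congD[OF that K]])
  qed
  have trans: "tensor_cong A B p r" if "tensor_cong A B p q" "tensor_cong A B q r" for p q r
  proof (rule tensor_congI)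
    fix eq assume K: "tensor_congruence A B eq"
    show "eq p r"
      by (rule tensor_congruence.trans[OF K tensor_congD[OF that(1) K] tensor_congD[OF that(2) K]])
  qed
  have cong: "tensor_cong A B = (\<lambda>p q. \<forall>eq. tensor_congruence A B eq \<longrightarrow> eq p q)"
    by (simp add: tensor_cong_def fun_eq_iff)
  show ?thesis
  proof (rule tensor_congruence.intro, goal_cases)
    case 1
    show ?case
    proof (rule equivI)
      show "{(p, q). tensor_cong A B p q} \<subseteq> Ar (formal A B) \<times> Ar (formal A B)"
        using par by auto
      show "refl_on (Ar (formal A B)) {(p, q). tensor_cong A B p q}"
        using refl by (simp add: refl_on_def)
      show "sym {(p, q). tensor_cong A B p q}"
        using sym by (simp add: sym_def)
      show "trans {(p, q). tensor_cong A B p q}"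
        using trans unfolding trans_def by blast
    qed
  next
    case (2 p q)
    then show ?case using par by blast
  next
    case (3 p p' q q')
    show ?case
    proof (rule tensor_congI)
      fix eq assume K: "tensor_congruence A B eq"
      show "eq (TCmp q p) (TCmp q' p')"
        by (rule tensor_congruence.cong_cmp[OF K 3(1,2)[THEN tensor_congD, OF K] 3(3)])
    qed
  next
    case (4 X p p')
    show ?case
    proof (rule tensor_congI)
      fix eq assume K: "tensor_congruence A B eq"
      show "eq (TLeft X p) (TLeft X p')"
        by (rule tensor_congruence.cong_left[OF K 4(1) tensor_congD[OF 4(2) K]])
    qed
  next
    case (5 X p p')
    show ?case
    proof (rule tensor_congI)
      fix eq assume K: "tensor_congruence A B eq"
      show "eq (TRight p X) (TRight p' X)"
        by (rule tensor_congruence.cong_right[OF K 5(1) tensor_congD[OF 5(2) K]])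
    qed
  next
    case 6
    show ?case
      by (rule tensor_congI, drule tensor_congruence.left_idn[OF _ 6], assumption)
  next
    case 7
    show ?case
      by (rule tensor_congI, drule tensor_congruence.left_cmp[OF _ 7], assumption)
  next
    case 8
    show ?case
      by (rule tensor_congI, drule tensor_congruence.right_idn[OF _ 8], assumption)
  next
    case 9
    show ?case
      by (rule tensor_congI, drule tensor_congruence.right_cmp[OF _ 9], assumption)
  next
    case 10
    show ?case
      by (rule tensor_congI, drule tensor_congruence.left_right[OF _ 10], assumption)
  next
    case 11
    show ?case unfolding cong by (intro smc_laws_inter tensor_congruence.smc)
  next
    case 12
    then show ?case unfolding cong by (intro smf_laws_inter tensor_congruence.left_functor)
  next
    case 13
    then show ?case unfolding cong by (intro smf_laws_inter tensor_congruence.right_functor)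
  next
    case 14
    then show ?case unfolding cong by (intro mnt_laws_inter tensor_congruence.left_transformation)
  next
    case 15
    then show ?case unfolding cong by (intro mnt_laws_inter tensor_congruence.right_transformation)
  next
    case 16
    show ?case
      by (rule tensor_congI, drule tensor_congruence.alpha_delta[OF _ 16], assumption)
  next
    case 17
    show ?case
      by (rule tensor_congI, drule tensor_congruence.beta_gamma[OF _ 17], assumption)
  next
    case 18
    show ?case
      by (rule tensor_congI, drule tensor_congruence.beta_alpha, assumption)
  next
    case 19
    show ?case
      by (rule tensor_congI, drule tensor_congruence.gamma_delta[OF _ 19], assumption)
  qed
qed

section \<open>Classes of formal arrows\<close>

context tensor_congruence
begin

abbreviation quot where
  "quot \<equiv> quotient_smc (formal A B) (\<approx>)"

lemma cls_eq: "p \<approx> q \<Longrightarrow> cls (\<approx>) p = cls (\<approx>) q"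
  unfolding cls_def using sym trans by blast

lemma rep_cls: "term_ok A B p \<Longrightarrow> rep (cls (\<approx>) p) \<approx> p"
  unfolding rep_def cls_def by (rule sym, rule someI2[of _ p]) (auto intro: refl)

lemma cls_Ar: "term_ok A B p \<Longrightarrow> cls (\<approx>) p \<in> Ar quot"
  by (auto simp: quotient_smc_def quotient_def cls_def)

lemma Ar_cls: 
  assumes "c \<in> Ar quot" obtains p where "term_ok A B p" "c = cls (\<approx>) p"
  using assms by (auto simp: quotient_smc_def quotient_def cls_def)

lemma cmp_cls:
  assumes "term_ok A B (TCmp q p)"
  shows "cls (\<approx>) q \<cdot>\<^bsub>quot\<^esub> cls (\<approx>) p = cls (\<approx>) (TCmp q p)"
proof -
  have r: "rep (cls (\<approx>) q) \<approx> q" "rep (cls (\<approx>) p) \<approx> p"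
    using assms by (auto intro: rep_cls)
  then have "TCmp (rep (cls (\<approx>) q)) (rep (cls (\<approx>) p)) \<approx> TCmp q p"
    using assms parallel[OF r(1)] parallel[OF r(2)] by (intro cong_cmp) auto
  then show ?thesis
    by (simp add: quotient_smc_def cls_eq)
qed

text \<open>
  The tensor of arrows is built from both one-sided operations. When one of the arrows is an
  identity, one of the two whiskered factors is an identity up to the congruence.
\<close>

lemma idn_ten_cls:
  assumes "word_ok A B X" "term_ok A B p" "word_ok A B (term_cod A B p)"
  shows "cls (\<approx>) (TIdn X) \<boxtimes>\<^bsub>quot\<^esub> cls (\<approx>) p = cls (\<approx>) (TLeft X p)"
proof -
  have r: "rep (cls (\<approx>) (TIdn X)) \<approx> TIdn X" "rep (cls (\<approx>) p) \<approx> p"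
    using assms by (auto intro: rep_cls)
  then have "rep (cls (\<approx>) (TIdn X)) \<boxtimes>\<^bsub>formal A B\<^esub> rep (cls (\<approx>) p) \<approx> TIdn X \<boxtimes>\<^bsub>formal A B\<^esub> p"
    using assms parallel[OF r(1)] parallel[OF r(2)] by (intro ten_cong) auto
  also have "\<dots> \<approx> TCmp (TIdn (WTen X (term_cod A B p))) (TLeft X p)"
    using assms by (auto intro!: cong_cmp right_idn refl)
  also have "\<dots> \<approx> TLeft X p"
    using assms by (intro idn_left) auto
  finally show ?thesis
    by (simp add: quotient_smc_def cls_eq)
qed

lemma ten_idn_cls:
  assumes "word_ok A B X" "term_ok A B p" "word_ok A B (term_dom A B p)"
  shows "cls (\<approx>) p \<boxtimes>\<^bsub>quot\<^esub> cls (\<approx>) (TIdn X) = cls (\<approx>) (TRight p X)"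
proof -
  have r: "rep (cls (\<approx>) (TIdn X)) \<approx> TIdn X" "rep (cls (\<approx>) p) \<approx> p"
    using assms by (auto intro: rep_cls)
  then have "rep (cls (\<approx>) p) \<boxtimes>\<^bsub>formal A B\<^esub> rep (cls (\<approx>) (TIdn X)) \<approx> p \<boxtimes>\<^bsub>formal A B\<^esub> TIdn X"
    using assms parallel[OF r(1)] parallel[OF r(2)] by (intro ten_cong) auto
  also have "\<dots> \<approx> TCmp (TRight p X) (TIdn (WTen (term_dom A B p) X))"
    using assms by (auto intro!: cong_cmp left_idn refl)
  also have "\<dots> \<approx> TRight p X"
    using assms by (intro idn_right) auto
  finally show ?thesis
    by (simp add: quotient_smc_def cls_eq)
qed

end

section \<open>Exchanging the two factors\<close>

primrec flip_word :: "('oa, 'ob) word \<Rightarrow> ('ob, 'oa) word" where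
  "flip_word WUnit = WUnit"
| "flip_word (WSym a b) = WSym b a"
| "flip_word (WTen X Y) = WTen (flip_word X) (flip_word Y)"

primrec flip :: "('oa, 'aa, 'ob, 'ab) arr_term \<Rightarrow> ('ob, 'ab, 'oa, 'aa) arr_term" where
  "flip (TIdn X) = TIdn (flip_word X)"
| "flip (TCmp q p) = TCmp (flip q) (flip p)"
| "flip (TLeft X p) = TLeft (flip_word X) (flip p)"
| "flip (TRight p X) = TRight (flip p) (flip_word X)"
| "flip (TAss X Y Z) = TAss (flip_word X) (flip_word Y) (flip_word Z)"
| "flip (TAssInv X Y Z) = TAssInv (flip_word X) (flip_word Y) (flip_word Z)"
| "flip (TRunit X) = TRunit (flip_word X)"
| "flip (TRunitInv X) = TRunitInv (flip_word X)"
| "flip (TLunit X) = TLunit (flip_word X)"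
| "flip (TLunitInv X) = TLunitInv (flip_word X)"
| "flip (TSymm X Y) = TSymm (flip_word X) (flip_word Y)"
| "flip (TAlpha b) = TBeta b"
| "flip (TBeta a) = TAlpha a"
| "flip (TGamma a a' b) = TDelta b a a'"
| "flip (TDelta a b b') = TGamma b b' a"
| "flip (TObAr a g) = TArOb g a"
| "flip (TArOb f b) = TObAr b f"

lemma flip_word_flip_word [simp]: "flip_word (flip_word X) = X"
  by (induction X) simp_all

lemma flip_flip [simp]: "flip (flip p) = p"
  by (induction p) simp_all

lemma word_ok_flip_word [simp]: "word_ok B A (flip_word X) \<longleftrightarrow> word_ok A B X"
  by (induction X) auto

lemma term_dom_flip [simp]: "term_dom B A (flip p) = flip_word (term_dom A B p)"
  by (induction p) simp_all

lemma term_cod_flip [simp]: "term_cod B A (flip p) = flip_word (term_cod A B p)"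
  by (induction p) simp_all

lemma flip_word_inject [simp]: "flip_word X = flip_word Y \<longleftrightarrow> X = Y"
  by (metis flip_word_flip_word)

lemma term_ok_flip [simp]: "term_ok B A (flip p) \<longleftrightarrow> term_ok A B p"
  by (induction p) auto

lemma flip_Ob: "X \<in> Ob (formal A B) \<Longrightarrow> flip_word X \<in> Ob (formal B A)"
  by simp

lemma flip_Hom:
  "p \<in> Hom (formal A B) X Y \<Longrightarrow> flip p \<in> Hom (formal B A) (flip_word X) (flip_word Y)"
  by simp

lemma flip_interchange [simp]:
  "flip (interchange (formal A B) X Y Z W) =
   interchange (formal B A) (flip_word X) (flip_word Y) (flip_word Z) (flip_word W)"
  by (simp add: interchange_def)

text \<open>
  Under \<open>flip\<close> the functors and transformations in the first variable trade places with those in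
  the second one, \<open>alpha_delta\<close> with \<open>beta_gamma\<close>, and \<open>beta_alpha\<close> is reversed. Only \<open>gamma_delta\<close>
  needs an argument, which is \<open>delta_gamma\<close>.
\<close>

lemma tensor_congruence_flip:
  assumes "tensor_congruence B A eq"
    and "smc_typing A" and "smc_typing B"
  shows "tensor_congruence A B (\<lambda>p q. eq (flip p) (flip q))"
proof -
  interpret tensor_congruence B A eq by fact
  interpret laws: smc_laws "formal B A" eq by (rule smc)
  interpret A: smc_typing A by fact
  interpret B: smc_typing B by fact
  let ?eq = "\<lambda>p q. eq (flip p) (flip q)"
  have smc: "smc_laws (formal A B) ?eq"
  proof (unfold_locales, goal_cases)
    case 1 show ?case using 1 laws.cmp_assoc[OF 1[THEN flip_Hom]] by simp
  next
    case 2 show ?case using 2 laws.idn_left[OF 2[THEN flip_Hom]] by simp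
  next
    case 3 show ?case using 3 laws.idn_right[OF 3[THEN flip_Hom]] by simp
  next
    case 4 show ?case using 4 laws.ten_idn[OF 4[THEN flip_Ob]] by simp
  next
    case 5 show ?case using 5 laws.ten_cmp[OF 5[THEN flip_Hom]] by simp
  next
    case 6 show ?case using 6 laws.ass_inv_ass[OF 6[THEN flip_Ob]] by simp
  next
    case 7 show ?case using 7 laws.ass_ass_inv[OF 7[THEN flip_Ob]] by simp
  next
    case 8 show ?case using 8 laws.runit_inv_runit[OF 8[THEN flip_Ob]] by simp
  next
    case 9 show ?case using 9 laws.runit_runit_inv[OF 9[THEN flip_Ob]] by simp
  next
    case 10 show ?case using 10 laws.lunit_inv_lunit[OF 10[THEN flip_Ob]] by simp
  next
    case 11 show ?case using 11 laws.lunit_lunit_inv[OF 11[THEN flip_Ob]] by simp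
  next
    case 12 show ?case using 12 laws.ass_nat[OF 12[THEN flip_Hom]] by simp
  next
    case 13 show ?case using 13 laws.runit_nat[OF 13[THEN flip_Hom]] by simp
  next
    case 14 show ?case using 14 laws.lunit_nat[OF 14[THEN flip_Hom]] by simp
  next
    case 15 show ?case using 15 laws.symm_nat[OF 15[THEN flip_Hom]] by simp
  next
    case 16 show ?case using 16 laws.symm_symm[OF 16[THEN flip_Ob]] by simp
  next
    case 17 show ?case using 17 laws.pentagon[OF 17[THEN flip_Ob]] by simp
  next
    case 18 show ?case using 18 laws.triangle[OF 18[THEN flip_Ob]] by simp
  next
    case 19 show ?case using 19 laws.hexagon[OF 19[THEN flip_Ob]] by simp
  next
    case 20 show ?case using 20 laws.runit_symm[OF 20[THEN flip_Ob]] by simp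
  qed
  have left: "smf_laws B (formal A B) ?eq (formal_left a)" if "a \<in> Ob A" for a
  proof -
    interpret R: smf_laws B "formal B A" eq "formal_right a"
      using that by (rule right_functor)
    show ?thesis
    proof (unfold_locales, goal_cases)
      case 1 then show ?case using R.far_idn by simp
    next case 2 then show ?case using R.far_cmp by simp
    next case 3 then show ?case using R.ftwo_nat by simp
    next case 4 then show ?case using R.ftwo_ass by simp
    next case 5 then show ?case using R.ftwo_runit by simp
    next case 6 then show ?case using R.ftwo_lunit by simp
    next case 7 then show ?case using R.ftwo_symm by simp
    qed
  qed
  have right: "smf_laws A (formal A B) ?eq (formal_right b)" if "b \<in> Ob B" for b
  proof -
    interpret L: smf_laws A "formal B A" eq "formal_left b"
      using that by (rule left_functor)
    show ?thesis
    proof (unfold_locales, goal_cases)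
      case 1 then show ?case using L.far_idn by simp
    next case 2 then show ?case using L.far_cmp by simp
    next case 3 then show ?case using L.ftwo_nat by simp
    next case 4 then show ?case using L.ftwo_ass by simp
    next case 5 then show ?case using L.ftwo_runit by simp
    next case 6 then show ?case using L.ftwo_lunit by simp
    next case 7 then show ?case using L.ftwo_symm by simp
    qed
  qed
  have left_nt: "mnt_laws B (formal A B) ?eq (formal_left a) (formal_left a') (TArOb f)"
    if "f \<in> Hom A a a'" for f a a'
  proof -
    interpret R: mnt_laws B "formal B A" eq "formal_right a" "formal_right a'" "\<lambda>b. TObAr b f"
      using that by (rule right_transformation)
    show ?thesis
    proof (unfold_locales, goal_cases)
      case 1 then show ?case using R.naturality by simp
    next case 2 then show ?case using R.monoidal_zero by simp
    next case 3 then show ?case using R.monoidal_two by simp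
    qed
  qed
  have right_nt: "mnt_laws A (formal A B) ?eq (formal_right b) (formal_right b') (\<lambda>a. TObAr a g)"
    if "g \<in> Hom B b b'" for g b b'
  proof -
    interpret L: mnt_laws A "formal B A" eq "formal_left b" "formal_left b'" "TArOb g"
      using that by (rule left_transformation)
    show ?thesis
    proof (unfold_locales, goal_cases)
      case 1 then show ?case using L.naturality by simp
    next case 2 then show ?case using L.monoidal_zero by simp
    next case 3 then show ?case using L.monoidal_two by simp
    qed
  qed
  show ?thesis
  proof (rule tensor_congruence.intro, goal_cases)
    case 1
    show ?case
    proof (rule equivI)
      show "{(p, q). ?eq p q} \<subseteq> Ar (formal A B) \<times> Ar (formal A B)"
        by (auto dest: ok)
      show "refl_on (Ar (formal A B)) {(p, q). ?eq p q}"
        by (simp add: refl_on_def refl)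
      show "sym {(p, q). ?eq p q}"
        by (simp add: sym_def sym)
      show "trans {(p, q). ?eq p q}"
        unfolding trans_def by (blast intro: trans)
    qed
  next case 2 then show ?case using parallel[OF 2] by simp
  next case 3 then show ?case using cong_cmp[OF 3(1,2)] by simp
  next case 4 then show ?case by (simp add: cong_left)
  next case 5 then show ?case by (simp add: cong_right)
  next case 6 then show ?case using left_idn by simp
  next case (7 X q p) then show ?case using left_cmp[of "flip_word X" "flip q" "flip p"] by simp
  next case 8 then show ?case using right_idn by simp
  next case (9 X q p) then show ?case using right_cmp[of "flip_word X" "flip q" "flip p"] by simp
  next case (10 p q) then show ?case using left_right[of "flip p" "flip q"] by simp
  next case 11 then show ?case by (rule smc)
  next case 12 then show ?case by (rule left)
  next case 13 then show ?case by (rule right)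
  next case 14 then show ?case by (rule left_nt)
  next case 15 then show ?case by (rule right_nt)
  next case 16 then show ?case using beta_gamma by simp
  next case 17 then show ?case using alpha_delta by simp
  next case 18 then show ?case using sym[OF beta_alpha] by simp
  next case (19 a a' b b')
    then show ?case using delta_gamma[of b b' a a'] A.ten_Ob B.ten_Ob by simp
  qed
qed

text \<open>
  A congruence for \<open>B \<otimes> A\<close> relates \<open>flip p\<close> and \<open>flip q\<close> because its pullback along \<open>flip\<close> is a
  congruence for \<open>A \<otimes> B\<close>, and so relates \<open>p\<close> and \<open>q\<close>.
\<close>

lemma tensor_cong_flip:
  assumes "smc_typing A" and "smc_typing B" and "tensor_cong A B p q"
  shows "tensor_cong B A (flip p) (flip q)"
  unfolding tensor_cong_def
proof (intro allI impI)
  fix eq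
  assume "tensor_congruence B A eq"
  then have "tensor_congruence A B (\<lambda>p q. eq (flip p) (flip q))"
    using assms(1,2) by (rule tensor_congruence_flip)
  from tensor_congD[OF assms(3) this] show "eq (flip p) (flip q)" .
qed

section \<open>The symmetry on classes\<close>

lemma tensor_simps [simp]:
  "Ob (tensor A B) = {X. word_ok A B X}"
  "idn (tensor A B) X = cls (tensor_cong A B) (TIdn X)"
  "unit_ob (tensor A B) = WUnit"
  "ten_ob (tensor A B) = WTen"
  "ass (tensor A B) X Y Z = cls (tensor_cong A B) (TAss X Y Z)"
  "ass_inv (tensor A B) X Y Z = cls (tensor_cong A B) (TAssInv X Y Z)"
  "runit (tensor A B) X = cls (tensor_cong A B) (TRunit X)"
  "runit_inv (tensor A B) X = cls (tensor_cong A B) (TRunitInv X)"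
  "lunit (tensor A B) X = cls (tensor_cong A B) (TLunit X)"
  "lunit_inv (tensor A B) X = cls (tensor_cong A B) (TLunitInv X)"
  "symm (tensor A B) X Y = cls (tensor_cong A B) (TSymm X Y)"
  by (simp_all add: tensor_def quotient_smc_def)

text \<open>
  Dualising exchanges the part of \<open>\<eta>\<close> that comes from its values with the part that comes from
  its own monoidal structure. On the generators this is exactly the effect of \<open>flip\<close>.
\<close>

lemma dual_eta_simps [simp]:
  fixes A :: "('oa, 'aa) smcat" and B :: "('ob, 'ab) smcat"
  defines "D \<equiv> dual B A (tensor B A) (eta B A)"
  shows "a \<in> Ob A \<Longrightarrow> b \<in> Ob B \<Longrightarrow> fob (fob D a) b = WSym b a"
    and "b \<in> Ob B \<Longrightarrow> mcomp (fzero D) b = cls (tensor_cong B A) (TBeta b)"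
    and "a \<in> Ob A \<Longrightarrow> fzero (fob D a) = cls (tensor_cong B A) (TAlpha a)"
    and "a \<in> Ob A \<Longrightarrow> a' \<in> Ob A \<Longrightarrow> b \<in> Ob B \<Longrightarrow>
      mcomp (ftwo D a a') b = cls (tensor_cong B A) (TDelta b a a')"
    and "a \<in> Ob A \<Longrightarrow> b \<in> Ob B \<Longrightarrow> b' \<in> Ob B \<Longrightarrow>
      ftwo (fob D a) b b' = cls (tensor_cong B A) (TGamma b b' a)"
    and "f \<in> Ar A \<Longrightarrow> b \<in> Ob B \<Longrightarrow> mcomp (far D f) b = cls (tensor_cong B A) (TObAr b f)"
    and "a \<in> Ob A \<Longrightarrow> g \<in> Ar B \<Longrightarrow> far (fob D a) g = cls (tensor_cong B A) (TArOb g a)"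
  by (simp_all add: D_def dual_def dual_ob_def eta_def eta_ob_def)

lemma en_word_dual_eta:
  "word_ok A B X \<Longrightarrow> en_word (tensor B A) (dual B A (tensor B A) (eta B A)) X = flip_word X"
  by (induction X) simp_all

text \<open>
  Evaluation at \<open>\<eta>\<^sup>*\<close> and the passage from \<open>p\<close> to the class of \<open>flip p\<close> agree on generators and
  commute with composition and the one-sided tensors, since composition and tensor of classes can be
  computed on any representatives.
\<close>

lemma en_term_dual_eta:
  assumes "smc_typing A" and "smc_typing B" and "term_ok A B p"
  shows "en_term (tensor B A) (dual B A (tensor B A) (eta B A)) p = cls (tensor_cong B A) (flip p)"
proof -
  interpret T: tensor_congruence B A "tensor_cong B A"
    using assms(2,1) by (rule tensor_congruence_tensor_cong)
  note word = word_ok_dom_cod[OF assms(1,2)]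
  show ?thesis
    using assms(3)
  proof (induction p)
    case (TCmp q p)
    then show ?case
      using T.cmp_cls[of "flip q" "flip p"] by (simp add: tensor_def)
  next
    case (TLeft X p)
    then show ?case
      using T.idn_ten_cls[of "flip_word X" "flip p", folded tensor_def] word[of p]
      by (simp add: en_word_dual_eta)
  next
    case (TRight p X)
    then show ?case
      using T.ten_idn_cls[of "flip_word X" "flip p", folded tensor_def] word[of p]
      by (simp add: en_word_dual_eta)
  qed (simp_all add: en_word_dual_eta)
qed

lemma fob_S: "word_ok A B X \<Longrightarrow> fob (S A B) X = flip_word X"
  by (simp add: S_def En_def strict_smf_def en_word_dual_eta)

lemma fzero_S: "fzero (S A B) = cls (tensor_cong B A) (TIdn WUnit)"
  by (simp add: S_def En_def strict_smf_def)

lemma ftwo_S: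
  "word_ok A B X \<Longrightarrow> word_ok A B Y \<Longrightarrow>
    ftwo (S A B) X Y = cls (tensor_cong B A) (TIdn (WTen (flip_word X) (flip_word Y)))"
  by (simp add: S_def En_def strict_smf_def en_word_dual_eta)

text \<open>
  \<open>S\<close> evaluates some representative of the class. The representative is related to \<open>p\<close>, so by
  \<open>tensor_cong_flip\<close> the choice does not matter.
\<close>

lemma far_S:
  assumes "smc_typing A" and "smc_typing B" and "term_ok A B p"
  shows "far (S A B) (cls (tensor_cong A B) p) = cls (tensor_cong B A) (flip p)"
proof -
  interpret T: tensor_congruence A B "tensor_cong A B"
    using assms(1,2) by (rule tensor_congruence_tensor_cong)
  interpret T': tensor_congruence B A "tensor_cong B A"
    using assms(2,1) by (rule tensor_congruence_tensor_cong)
  let ?r = "rep (cls (tensor_cong A B) p)"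
  have r: "tensor_cong A B ?r p"
    using assms(3) by (rule T.rep_cls)
  have "far (S A B) (cls (tensor_cong A B) p) =
      en_term (tensor B A) (dual B A (tensor B A) (eta B A)) ?r"
    using T.cls_Ar[OF assms(3), folded tensor_def] by (simp add: S_def En_def strict_smf_def)
  also have "\<dots> = cls (tensor_cong B A) (flip ?r)"
    using assms(1,2) T.ok[OF r] by (simp add: en_term_dual_eta)
  also have "\<dots> = cls (tensor_cong B A) (flip p)"
    using tensor_cong_flip[OF assms(1,2) r] by (rule T'.cls_eq)
  finally show ?thesis .
qed

theorem lemma19p2:
  fixes A :: "('oa, 'aa) smcat" and B :: "('ob, 'ab) smcat"
  assumes "symmetric_monoidal_category A" and "symmetric_monoidal_category B"
  shows "smf_comp (tensor A B) (tensor A B) (S B A) (S A B) = smf_id (tensor A B)"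
proof -
  have A: "smc_typing A" and B: "smc_typing B"
    using assms by (simp_all add: symmetric_monoidal_category_def)
  interpret T: tensor_congruence A B "tensor_cong A B"
    using A B by (rule tensor_congruence_tensor_cong)
  note far = far_S[OF A B] far_S[OF B A]
  (* The structure arrows of the composite are composites of two identities. *)
  have cancel: "cls (tensor_cong A B) (TIdn X) \<cdot>\<^bsub>tensor A B\<^esub> cls (tensor_cong A B) (TIdn X) =
      cls (tensor_cong A B) (TIdn X)" if "word_ok A B X" for X
    using that T.cmp_cls[of "TIdn X" "TIdn X"] T.cls_eq[OF T.idn_left[of "TIdn X" X]]
    by (simp add: tensor_def)
  have "far (S B A) (far (S A B) c) = c" if "c \<in> Ar (tensor A B)" for c
    using that[unfolded tensor_def] by (rule T.Ar_cls) (simp add: far)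
  then show ?thesis
    by (simp add: smf_comp_def smf_id_def fob_S fzero_S ftwo_S far cancel cong: restrict_cong)
qed

end
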